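(* Let $\{\mathcal{F}_t\}$ be a Veronese web on $\mathbb{R}^2$. The associated connection $\nabla^{\mathcal{F}}$ has the following properties: (a) All leaves of $\mathcal{F}_t$ are (unparametrised) geodesics of $\nabla^{\mathcal{F}}$ for any $t\in\mathbb{R}$. (b) The torsion of $\nabla^{\mathcal{F}}$ vanishes. (c) The Ricci curvature tensor of $\nabla^{\mathcal{F}}$ is skew-symmetric.
   Context: Everything is smooth. A Veronese web on $\mathbb{R}^2$ is a family $\{\mathcal{F}_{(s:t)}\}_{(s:t)\in\mathbb{R}P^1}$ of one-dimensional foliations such that every point has a neighbourhood $U$ with pointwise linearly independent one-forms $\omega_0,\omega_1$ on $U$ satisfying $T\mathcal{F}_{(s:t)}|_U=\ker(s\omega_0+t\omega_1)$ for all $(s:t)\in\mathbb{R}P^1$. One writes $\mathcal{F}_t=\mathcal{F}_{(1:t)}$ for $t\in\mathbb{R}$ and $\mathcal{F}_\infty=\mathcal{F}_{(0:1)}$. The associated connection $\nabla^{\mathcal{F}}$ is defined as follows. Fix $t_0\in\mathbb{R}\setminus\{0\}$. Near any point there are local coordinates $(x,y)$ and a function $w$ with $w_x,w_y$ nowhere zero such that $T\mathcal{F}_0=\ker dx$, $T\mathcal{F}_\infty=\ker dy$, $T\mathcal{F}_{t_0}=\ker dw$, and then $T\mathcal{F}_t=\ker(t_0w_x\,dx+t\,w_y\,dy)$ for all $t$. In such coordinates $$\nabla^{\mathcal{F}}_{\partial_x}\partial_x=\frac{w_yw_{xx}-w_xw_{xy}}{w_xw_y}\,\partial_x,\quad \nabla^{\mathcal{F}}_{\partial_y}\partial_y=\frac{w_xw_{yy}-w_yw_{xy}}{w_xw_y}\,\partial_y,\quad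 \nabla^{\mathcal{F}}_{\partial_x}\partial_y=\nabla^{\mathcal{F}}_{\partial_y}\partial_x=0,$$ independently of the choices of $t_0$, $(x,y)$ and $w$. The Ricci tensor of a connection with curvature $R$ is $Ric(Y,Z)=\mathrm{tr}\,(X\mapsto R(X,Y)Z)$; the zero tensor counts as skew-symmetric. *)

theory Defs
  imports "HOL-Analysis.Analysis"
begin

section \<open>Smooth maps and vector fields\<close>

text \<open>
  On an open subset of a Euclidean space, \<open>Ck_on k S f\<close> is the usual class C^k: all iterated
  directional derivatives up to order \<open>k\<close> exist and are continuous.
\<close>

primrec Ck_on ::
  "nat \<Rightarrow> 'a::real_normed_vector set \<Rightarrow> ('a \<Rightarrow> 'b::real_normed_vector) \<Rightarrow> bool" where
  "Ck_on 0 S f \<longleftrightarrow> continuous_on S f"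
| "Ck_on (Suc k) S f \<longleftrightarrow> (\<forall>x\<in>S. f differentiable (at x)) \<and>
     (\<forall>v. Ck_on k S (\<lambda>x. frechet_derivative f (at x) v))"

definition smooth_on ::
  "'a::real_normed_vector set \<Rightarrow> ('a \<Rightarrow> 'b::real_normed_vector) \<Rightarrow> bool" where
  "smooth_on S f \<longleftrightarrow> (\<forall>k. Ck_on k S f)"

type_synonym vfield = "real^2 \<Rightarrow> real^2"

text \<open>
  For a real-valued \<open>f\<close>, \<open>dirderiv X f\<close> is the function \<open>X(f) = df(X)\<close>; for a vector-valued one
  it is the componentwise derivative.
\<close>

definition dirderiv :: "vfield \<Rightarrow> (real^2 \<Rightarrow> 'b::real_normed_vector) \<Rightarrow> real^2 \<Rightarrow> 'b" where
  "dirderiv X f p = frechet_derivative f (at p) (X p)"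

definition lie_bracket :: "vfield \<Rightarrow> vfield \<Rightarrow> vfield" where
  "lie_bracket X Y p = dirderiv X Y p - dirderiv Y X p"

definition smooth_chart :: "(real^2) set \<Rightarrow> (real^2 \<Rightarrow> real^2) \<Rightarrow> bool" where
  "smooth_chart U \<phi> \<longleftrightarrow> open U \<and> open (\<phi> ` U) \<and> inj_on \<phi> U \<and>
     smooth_on U \<phi> \<and> smooth_on (\<phi> ` U) (inv_into U \<phi>)"

text \<open>
  The coordinate vector field \<open>\<partial>/\<partial>x\<^sup>i\<close> of the chart \<open>\<phi> = (x\<^sup>1, x\<^sup>2)\<close>, as the push-forward of the
  \<open>i\<close>-th standard basis vector under the inverse of \<open>\<phi>\<close>.
\<close>

definition coord_field :: "(real^2) set \<Rightarrow> (real^2 \<Rightarrow> real^2) \<Rightarrow> 2 \<Rightarrow> vfield" where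
  "coord_field U \<phi> i q = frechet_derivative (inv_into U \<phi>) (at (\<phi> q)) (axis i 1)"


section \<open>Foliations and Veronese webs\<close>

text \<open>
  A one-dimensional foliation of the plane is represented by its set of leaves: a partition of
  the plane into path-connected sets which in suitable charts onto open rectangles are unions of
  plaques \<open>x\<^sup>2 = const\<close>, the plaques being the connected components.
\<close>

definition foliated_chart ::
  "(real^2) set set \<Rightarrow> (real^2) set \<Rightarrow> (real^2 \<Rightarrow> real^2) \<Rightarrow> bool" where
  "foliated_chart \<L> U \<phi> \<longleftrightarrow> smooth_chart U \<phi> \<and> (\<exists>a b. \<phi> ` U = box a b) \<and>
     (\<forall>L\<in>\<L>. \<forall>C\<in>components (U \<inter> L). \<exists>c. C = {q\<in>U. \<phi> q $ 2 = c})"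

definition foliation :: "(real^2) set set \<Rightarrow> bool" where
  "foliation \<L> \<longleftrightarrow> partition_on UNIV \<L> \<and> (\<forall>L\<in>\<L>. path_connected L) \<and>
     (\<forall>p. \<exists>U \<phi>. p \<in> U \<and> foliated_chart \<L> U \<phi>)"

definition tangent :: "(real^2) set set \<Rightarrow> real^2 \<Rightarrow> (real^2) set" where
  "tangent \<L> p = {v. \<exists>L\<in>\<L>. \<exists>\<gamma> e. e > 0 \<and> smooth_on {-e<..<e} \<gamma> \<and>
     \<gamma> ` {-e<..<e} \<subseteq> L \<and> \<gamma> 0 = p \<and> vector_derivative \<gamma> (at 0) = v}"

text \<open>
  The parameter in the real projective line is given by homogeneous coordinates: \<open>F s t\<close> is the
  foliation with parameter \<open>(s:t)\<close>, and \<open>F 0 0\<close> is irrelevant.  Thus \<open>F\<^sub>t\<close> is \<open>F 1 t\<close>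
  and \<open>F\<^sub>\<infinity>\<close> is \<open>F 0 1\<close>.
\<close>

definition veronese_web :: "(real \<Rightarrow> real \<Rightarrow> (real^2) set set) \<Rightarrow> bool" where
  "veronese_web F \<longleftrightarrow>
     (\<forall>s t. (s, t) \<noteq> (0, 0) \<longrightarrow> foliation (F s t)) \<and>
     (\<forall>s t c. (s, t) \<noteq> (0, 0) \<and> c \<noteq> 0 \<longrightarrow> F (c * s) (c * t) = F s t) \<and>
     (\<forall>p. \<exists>U. \<exists>\<omega>\<^sub>0 \<omega>\<^sub>1 :: real^2 \<Rightarrow> ((real^2) \<Rightarrow>\<^sub>L real).
        open U \<and> p \<in> U \<and> smooth_on U \<omega>\<^sub>0 \<and> smooth_on U \<omega>\<^sub>1 \<and>
        (\<forall>q\<in>U. (\<forall>a b. a *\<^sub>R \<omega>\<^sub>0 q + b *\<^sub>R \<omega>\<^sub>1 q = 0 \<longrightarrow> a = 0 \<and> b = 0) \<and>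
           (\<forall>s t. (s, t) \<noteq> (0, 0) \<longrightarrow>
              tangent (F s t) q = {v. blinfun_apply (s *\<^sub>R \<omega>\<^sub>0 q + t *\<^sub>R \<omega>\<^sub>1 q) v = 0})))"


section \<open>The associated connection\<close>

text \<open>Local coordinates \<open>\<phi> = (x, y)\<close> on \<open>U\<close> and the function \<open>w\<close>, adapted to the web.\<close>

definition adapted ::
  "(real \<Rightarrow> real \<Rightarrow> (real^2) set set) \<Rightarrow> real \<Rightarrow> (real^2) set \<Rightarrow> (real^2 \<Rightarrow> real^2) \<Rightarrow>
   (real^2 \<Rightarrow> real) \<Rightarrow> bool" where
  "adapted F t\<^sub>0 U \<phi> w \<longleftrightarrow> smooth_chart U \<phi> \<and> smooth_on U w \<and>
     (\<forall>q\<in>U. dirderiv (coord_field U \<phi> 1) w q \<noteq> 0 \<and> dirderiv (coord_field U \<phi> 2) w q \<noteq> 0 \<and>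
        tangent (F 1 0) q = {v. frechet_derivative (\<lambda>r. \<phi> r $ 1) (at q) v = 0} \<and>
        tangent (F 0 1) q = {v. frechet_derivative (\<lambda>r. \<phi> r $ 2) (at q) v = 0} \<and>
        tangent (F 1 t\<^sub>0) q = {v. frechet_derivative w (at q) v = 0})"

text \<open>
  \<open>christoffel U \<phi> w k i j\<close> is the coefficient of \<open>\<partial>\<^sub>k\<close> in the covariant derivative of \<open>\<partial>\<^sub>j\<close> along
  \<open>\<partial>\<^sub>i\<close>.
\<close>

definition christoffel ::
  "(real^2) set \<Rightarrow> (real^2 \<Rightarrow> real^2) \<Rightarrow> (real^2 \<Rightarrow> real) \<Rightarrow> 2 \<Rightarrow> 2 \<Rightarrow> 2 \<Rightarrow> real^2 \<Rightarrow> real" where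
  "christoffel U \<phi> w k i j q =
     (let Dx = dirderiv (coord_field U \<phi> 1); Dy = dirderiv (coord_field U \<phi> 2);
          wx = Dx w q; wy = Dy w q;
          wxx = Dx (Dx w) q; wxy = Dy (Dx w) q; wyy = Dy (Dy w) q
      in if k = 1 \<and> i = 1 \<and> j = 1 then (wy * wxx - wx * wxy) / (wx * wy)
         else if k = 2 \<and> i = 2 \<and> j = 2 then (wx * wyy - wy * wxy) / (wx * wy)
         else 0)"

text \<open>
  The connection with these coefficients, i.e.
  \<open>\<Sum>\<^sub>k (X(Y\<^sup>k) + \<Sum>\<^sub>i\<^sub>j \<Gamma>\<^sup>k\<^sub>i\<^sub>j X\<^sup>i Y\<^sup>j) \<partial>\<^sub>k\<close>, where \<open>X\<^sup>i = dx\<^sup>i(X)\<close> and \<open>Y\<^sup>j = dx\<^sup>j(Y)\<close> are the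
  components with respect to the chart.
\<close>

definition local_connection ::
  "(real^2) set \<Rightarrow> (real^2 \<Rightarrow> real^2) \<Rightarrow> (real^2 \<Rightarrow> real) \<Rightarrow> vfield \<Rightarrow> vfield \<Rightarrow> vfield" where
  "local_connection U \<phi> w X Y q =
     (let cmp = (\<lambda>Z i r. dirderiv Z (\<lambda>p. \<phi> p $ i) r)
      in \<Sum>k\<in>UNIV. (dirderiv X (cmp Y k) q +
           (\<Sum>i\<in>UNIV. \<Sum>j\<in>UNIV. christoffel U \<phi> w k i j q * cmp X i q * cmp Y j q))
         *\<^sub>R coord_field U \<phi> k q)"

text \<open>
  At each point the connection is computed in some adapted coordinates around that point; the
  result does not depend on which ones are selected.
\<close>

definition web_connection ::
  "(real \<Rightarrow> real \<Rightarrow> (real^2) set set) \<Rightarrow> real \<Rightarrow> vfield \<Rightarrow> vfield \<Rightarrow> vfield" where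
  "web_connection F t\<^sub>0 X Y p =
     (case (SOME (U, \<phi>, w). p \<in> U \<and> adapted F t\<^sub>0 U \<phi> w) of
        (U, \<phi>, w) \<Rightarrow> local_connection U \<phi> w X Y p)"


section \<open>Torsion, Ricci tensor and geodesics\<close>

definition torsion :: "(vfield \<Rightarrow> vfield \<Rightarrow> vfield) \<Rightarrow> vfield \<Rightarrow> vfield \<Rightarrow> vfield" where
  "torsion nab X Y p = nab X Y p - nab Y X p - lie_bracket X Y p"

definition curvature :: "(vfield \<Rightarrow> vfield \<Rightarrow> vfield) \<Rightarrow> vfield \<Rightarrow> vfield \<Rightarrow> vfield \<Rightarrow> vfield" where
  "curvature nab X Y Z p = nab X (nab Y Z) p - nab Y (nab X Z) p - nab (lie_bracket X Y) Z p"

text \<open>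
  Curvature is tensorial, so a tangent vector \<open>v\<close> at \<open>p\<close> may be inserted as a constant field.
\<close>

definition ricci :: "(vfield \<Rightarrow> vfield \<Rightarrow> vfield) \<Rightarrow> vfield \<Rightarrow> vfield \<Rightarrow> real^2 \<Rightarrow> real" where
  "ricci nab Y Z p = trace (matrix (\<lambda>v. curvature nab (\<lambda>_. v) Y Z p))"

text \<open>
  Covariant derivative of the velocity along a curve.  In the standard coordinates of the plane
  the second summand is \<open>\<Gamma>\<^sup>k\<^sub>i\<^sub>j (\<gamma>\<^sup>i)' (\<gamma>\<^sup>j)'\<close>, since the fields inserted are constant.
\<close>

definition acceleration ::
  "(vfield \<Rightarrow> vfield \<Rightarrow> vfield) \<Rightarrow> (real \<Rightarrow> real^2) \<Rightarrow> real \<Rightarrow> real^2" where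
  "acceleration nab \<gamma> \<tau> =
     (let v = vector_derivative \<gamma> (at \<tau>)
      in vector_derivative (\<lambda>\<sigma>. vector_derivative \<gamma> (at \<sigma>)) (at \<tau>) + nab (\<lambda>_. v) (\<lambda>_. v) (\<gamma> \<tau>))"

definition regular_curve_in :: "(real^2) set \<Rightarrow> real \<Rightarrow> real \<Rightarrow> (real \<Rightarrow> real^2) \<Rightarrow> bool" where
  "regular_curve_in L a b \<gamma> \<longleftrightarrow> smooth_on {a<..<b} \<gamma> \<and> \<gamma> ` {a<..<b} \<subseteq> L \<and>
     (\<forall>\<tau>\<in>{a<..<b}. vector_derivative \<gamma> (at \<tau>) \<noteq> 0)"

text \<open>
  \<open>L\<close> is a regularly parametrisable curve near each of its points, and every regular
  parametrisation of a piece of \<open>L\<close> has acceleration proportional to its velocity, i.e. becomes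
  a geodesic after a change of parameter.
\<close>

definition unparametrised_geodesic ::
  "(vfield \<Rightarrow> vfield \<Rightarrow> vfield) \<Rightarrow> (real^2) set \<Rightarrow> bool" where
  "unparametrised_geodesic nab L \<longleftrightarrow>
     (\<forall>p\<in>L. \<exists>\<gamma> e. e > 0 \<and> regular_curve_in L (-e) e \<gamma> \<and> \<gamma> 0 = p) \<and>
     (\<forall>a b \<gamma>. regular_curve_in L a b \<gamma> \<longrightarrow>
        (\<forall>\<tau>\<in>{a<..<b}. \<exists>c. acceleration nab \<gamma> \<tau> = c *\<^sub>R vector_derivative \<gamma> (at \<tau>)))"

end

(*
  In adapted coordinates the connection depends on w only through r = w_x / w_y: its two nonzero
  coefficients are the logarithmic derivatives (ln r)_x and -(ln r)_y.  Passing to other adapted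
  coordinates multiplies r by a function of x times a function of y and changes the coefficients
  exactly as a connection requires, so all adapted coordinates give the same operator.  Commuting
  second derivatives yield vanishing torsion.  The curvature is R(X,Y)Z = k(X,Y) Z for a two-form k
  with coefficient -(ln r)_xy, so Ric(Y,Z) = k(Z,Y) is skew.  A curve tangent to F_t satisfies
  t_0 r x' + t y' = 0, and differentiating this relation makes its acceleration parallel to its
  velocity.  Adapted coordinates exist because the transverse coordinates of foliated charts are
  first integrals of F_0 and F_oo with independent differentials.
*)

theory Submission
  imports Defs
begin

section \<open>Calculus of smooth maps\<close>

text \<open>\<open>web_connection\<close> picks its coordinates by SOME at every point separately,
  so it comes with no regularity in the point, yet the curvature differentiates
  \<open>nab Y Z\<close>. The choices made at different points must therefore be compared, and this
  shapes the hypotheses below. At \<open>p\<close> itself the operator is a local connection on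
  arbitrary fields; the outer derivative needs this, since it acts on \<open>nab Y Z\<close>, whose
  smoothness is not known. At the other points of the chart, agreement for smooth second arguments
  suffices for the inner derivative.

  Identities between vectors are checked against the two coordinate differentials. Since the
  Christoffel symbols are diagonal, the k-th component of \<open>nab X Y\<close> involves, besides
  the derivative along \<open>X\<close>, only the k-th components of \<open>X\<close> and
  \<open>Y\<close>.

  Leaves are given as sets and their tangents by curves. That tangents are kernels of differentials
  of functions combines two sources: plaques supply one tangent direction, and the forms of the web
  show that the tangent set is a line.\<close>

abbreviation Dv :: "('a::real_normed_vector \<Rightarrow> 'b::real_normed_vector) \<Rightarrow> 'a \<Rightarrow> 'a \<Rightarrow> 'b" where
  "Dv f q \<equiv> frechet_derivative f (at q)"

lemma Dv_eqI: "(f has_derivative f') (at x) \<Longrightarrow> Dv f x = f'"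
  by (metis frechet_derivative_at)

text \<open>No differentiability is assumed: \<open>f\<close> and \<open>g\<close> have the same
  derivatives at \<open>x\<close>, and \<open>frechet_derivative\<close> selects from this common
  set, even if it is empty.\<close>

lemma Dv_cong_open:
  assumes "open S" "x \<in> S" "\<And>y. y \<in> S \<Longrightarrow> f y = g y"
  shows "Dv f x = Dv g x"
proof -
  have "(f has_derivative f') (at x) \<longleftrightarrow> (g has_derivative f') (at x)" for f'
    using assms has_derivative_transform_within_open[of _ f' x UNIV S] by (metis)
  then show ?thesis
    unfolding frechet_derivative_def by simp
qed

lemma differentiable_cong_open:
  assumes "f differentiable (at x)" "open S" "x \<in> S" "\<And>y. y \<in> S \<Longrightarrow> f y = g y"
  shows "g differentiable (at x)"
  using assms has_derivative_transform_within_open[of f _ x UNIV S] unfolding differentiable_def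
  by metis

lemma has_derivative_Dv: "f differentiable (at x) \<Longrightarrow> (f has_derivative Dv f x) (at x)"
  by (simp add: frechet_derivative_works)

lemma linear_Dv:
  assumes "f differentiable (at x)"
  shows "Dv f x (a + b) = Dv f x a + Dv f x b" "Dv f x (c *\<^sub>R a) = c *\<^sub>R Dv f x a"
    "Dv f x (a - b) = Dv f x a - Dv f x b" "Dv f x 0 = 0"
  using linear_frechet_derivative[OF assms]
  by (simp_all add: linear_add linear_scale linear_diff linear_0)

section \<open>Closure properties of the classes C^k\<close>

lemma Ck_on_cong:
  assumes "open S" "\<And>x. x \<in> S \<Longrightarrow> f x = g x" "Ck_on k S f"
  shows "Ck_on k S g"
  using assms(2,3)
proof (induction k arbitrary: f g)
  case 0
  then show ?case using continuous_on_cong[of S S f g] by simp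
next
  case (Suc k)
  have "Ck_on k S (\<lambda>x. Dv g x v)" for v
    by (rule Suc.IH[of "\<lambda>x. Dv f x v"])
      (use Suc.prems Dv_cong_open[OF assms(1) _ Suc.prems(1)] in auto)
  moreover have "g differentiable (at x)" if "x \<in> S" for x
    using Suc.prems that differentiable_cong_open[OF _ assms(1) that] by auto
  ultimately show ?case by simp
qed

lemma Ck_on_subset: "Ck_on k S f \<Longrightarrow> T \<subseteq> S \<Longrightarrow> Ck_on k T f"
  by (induction k arbitrary: f) (auto intro: continuous_on_subset)

lemma Ck_on_imp_continuous_on: "Ck_on k S f \<Longrightarrow> continuous_on S f"
  by (cases k) (auto intro!: differentiable_imp_continuous_on
      simp: differentiable_on_def differentiable_at_withinI)

lemma Ck_on_Suc_imp: "Ck_on (Suc k) S f \<Longrightarrow> Ck_on k S f"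
proof (induction k arbitrary: f)
  case 0
  then show ?case using Ck_on_imp_continuous_on by fastforce
next
  case (Suc k)
  then show ?case by (metis Ck_on.simps(2))
qed

lemma Ck_on_const: "Ck_on k S (\<lambda>x. c)"
  by (induction k arbitrary: c) simp_all

lemma Ck_on_bounded_linear:
  assumes "bounded_linear h"
  shows "Ck_on k S h"
proof (cases k)
  case (Suc m)
  have "Dv h x = h" for x
    by (rule Dv_eqI) (rule bounded_linear_imp_has_derivative[OF assms])
  then show ?thesis
    using Suc assms by (auto simp: Ck_on_const intro: bounded_linear_imp_differentiable)
qed (use assms in \<open>auto intro: linear_continuous_on\<close>)

lemma Ck_on_linear_compose:
  assumes "bounded_linear h" "open S" "Ck_on k S f"
  shows "Ck_on k S (\<lambda>x. h (f x))"
  using assms(3)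
proof (induction k arbitrary: f)
  case 0
  then show ?case
    using bounded_linear.continuous_on[OF assms(1)] by auto
next
  case (Suc k)
  have d: "((\<lambda>x. h (f x)) has_derivative (\<lambda>v. h (Dv f x v))) (at x)" if "x \<in> S" for x
    using Suc.prems that by (intro bounded_linear.has_derivative[OF assms(1)] has_derivative_Dv) auto
  have "Ck_on k S (\<lambda>x. Dv (\<lambda>x. h (f x)) x v)" for v
    by (rule Ck_on_cong[OF assms(2) _ Suc.IH[of "\<lambda>x. Dv f x v"]])
      (use Dv_eqI[OF d] Suc.prems in auto)
  with d show ?case by (auto simp: differentiable_def)
qed

lemma Ck_on_add:
  assumes "open S" "Ck_on k S f" "Ck_on k S g"
  shows "Ck_on k S (\<lambda>x. f x + g x)"
  using assms(2,3)
proof (induction k arbitrary: f g)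
  case 0
  then show ?case by (auto intro: continuous_intros)
next
  case (Suc k)
  have d: "((\<lambda>x. f x + g x) has_derivative (\<lambda>v. Dv f x v + Dv g x v)) (at x)" if "x \<in> S" for x
    using Suc.prems that by (intro has_derivative_add has_derivative_Dv) auto
  have "Ck_on k S (\<lambda>x. Dv (\<lambda>x. f x + g x) x v)" for v
    by (rule Ck_on_cong[OF assms(1) _ Suc.IH[of "\<lambda>x. Dv f x v" "\<lambda>x. Dv g x v"]])
      (use Dv_eqI[OF d] Suc.prems in auto)
  with d show ?case by (auto simp: differentiable_def)
qed

lemma Ck_on_sum:
  assumes "open S" "finite I" "\<And>i. i \<in> I \<Longrightarrow> Ck_on k S (f i)"
  shows "Ck_on k S (\<lambda>x. \<Sum>i\<in>I. f i x)"
  using assms(2,3) by (induction I) (auto simp: Ck_on_const intro: Ck_on_add[OF assms(1)])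

lemma Ck_on_bilinear:
  assumes "bounded_bilinear B" "open S" "Ck_on k S f" "Ck_on k S g"
  shows "Ck_on k S (\<lambda>x. B (f x) (g x))"
  using assms(3,4)
proof (induction k arbitrary: f g)
  case 0
  then show ?case using bounded_bilinear.continuous_on[OF assms(1)] by auto
next
  case (Suc k)
  have d: "((\<lambda>x. B (f x) (g x)) has_derivative
      (\<lambda>v. B (f x) (Dv g x v) + B (Dv f x v) (g x))) (at x)" if "x \<in> S" for x
    using Suc.prems that by (intro bounded_bilinear.FDERIV[OF assms(1)] has_derivative_Dv) auto
  have "Ck_on k S (\<lambda>x. Dv (\<lambda>x. B (f x) (g x)) x v)" for v
  proof (rule Ck_on_cong[OF assms(2)])
    \<comment> \<open>Each summand of the product rule keeps one factor undifferentiated; that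
      factor is weakened from order \<open>Suc k\<close> to \<open>k\<close> so that the induction
      hypothesis applies.\<close>
    show "Ck_on k S (\<lambda>x. B (f x) (Dv g x v) + B (Dv f x v) (g x))"
      using Suc.prems Ck_on_Suc_imp[OF Suc.prems(1)] Ck_on_Suc_imp[OF Suc.prems(2)]
      by (intro Ck_on_add[OF assms(2)] Suc.IH) auto
  qed (use Dv_eqI[OF d] in auto)
  with d show ?case by (auto simp: differentiable_def)
qed

text \<open>The derivative of 1/f is a product of 1/f, f' and 1/f, so induction on the order closes
  with \<open>f\<close> fixed.\<close>

lemma Ck_on_inverse:
  fixes f :: "'a::real_normed_vector \<Rightarrow> real"
  assumes "open S" "\<And>x. x \<in> S \<Longrightarrow> f x \<noteq> 0" "Ck_on k S f"
  shows "Ck_on k S (\<lambda>x. inverse (f x))"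
  using assms(3)
proof (induction k)
  case 0
  then show ?case using assms(2) by (auto intro: continuous_intros)
next
  case (Suc k)
  have d: "((\<lambda>x. inverse (f x)) has_derivative
      (\<lambda>v. - (inverse (f x) * Dv f x v * inverse (f x)))) (at x)" if "x \<in> S" for x
  proof (rule Deriv.has_derivative_inverse)
    show "f x \<noteq> 0" by (rule assms(2)[OF that])
    show "(f has_derivative Dv f x) (at x)"
      using Suc.prems that by (simp add: has_derivative_Dv)
  qed
  have inv: "Ck_on k S (\<lambda>x. inverse (f x))"
    by (rule Suc.IH[OF Ck_on_Suc_imp[OF Suc.prems]])
  have "Ck_on k S (\<lambda>x. Dv (\<lambda>x. inverse (f x)) x v)" for v
  proof (rule Ck_on_cong[OF assms(1)])
    show "Ck_on k S (\<lambda>x. - (inverse (f x) * Dv f x v * inverse (f x)))"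
      using Suc.prems
      by (intro Ck_on_linear_compose[OF bounded_linear_minus[OF bounded_linear_ident] assms(1)]
          Ck_on_bilinear[OF bounded_bilinear_mult assms(1)] inv) simp
    show "- (inverse (f x) * Dv f x v * inverse (f x)) = Dv (\<lambda>x. inverse (f x)) x v" if "x \<in> S" for x
      using Dv_eqI[OF d[OF that]] by simp
  qed
  with d show ?case by (auto simp: differentiable_def)
qed

text \<open>\<open>Ck_on\<close> controls derivatives in fixed directions only; directions that move
  with the point are reduced to these by expansion in the standard basis.\<close>

lemma Dv_euclidean:
  fixes f :: "'a::euclidean_space \<Rightarrow> 'b::real_normed_vector"
  assumes "f differentiable (at x)"
  shows "Dv f x v = (\<Sum>b\<in>Basis. (v \<bullet> b) *\<^sub>R Dv f x b)"
proof -
  have "Dv f x v = Dv f x (\<Sum>b\<in>Basis. (v \<bullet> b) *\<^sub>R b)"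
    by (simp add: euclidean_representation)
  also have "\<dots> = (\<Sum>b\<in>Basis. (v \<bullet> b) *\<^sub>R Dv f x b)"
    by (simp add: linear_sum[OF linear_frechet_derivative[OF assms]] linear_scale[OF linear_frechet_derivative[OF assms]])
  finally show ?thesis .
qed

text \<open>The chain rule evaluates \<open>Dv f\<close> in the moving direction
  \<open>Dv g x v\<close>. After expansion in the basis the coefficients \<open>Dv f (g x) b\<close>
  are again compositions with the same \<open>g\<close>, so the induction varies \<open>f\<close>
  and keeps \<open>g\<close>.\<close>

lemma Ck_on_compose:
  fixes f :: "'b::euclidean_space \<Rightarrow> 'c::real_normed_vector" and g :: "'a::real_normed_vector \<Rightarrow> 'b"
  assumes "open S" "g ` S \<subseteq> T" "Ck_on k T f" "Ck_on k S g"
  shows "Ck_on k S (\<lambda>x. f (g x))"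
  using assms(3,4)
proof (induction k arbitrary: f)
  case 0
  then show ?case using assms(2) continuous_on_compose2[of T f S g] by simp
next
  case (Suc k)
  have d: "((\<lambda>x. f (g x)) has_derivative (\<lambda>v. Dv f (g x) (Dv g x v))) (at x)" if "x \<in> S" for x
    using Suc.prems that assms(2)
    by (intro has_derivative_compose[OF has_derivative_Dv has_derivative_Dv]) auto
  have "Ck_on k S (\<lambda>x. Dv (\<lambda>x. f (g x)) x v)" for v
  proof (rule Ck_on_cong[OF assms(1)])
    show "Ck_on k S (\<lambda>x. \<Sum>b\<in>Basis. (Dv g x v \<bullet> b) *\<^sub>R Dv f (g x) b)"
      using Suc.prems Suc.IH[OF _ Ck_on_Suc_imp[OF Suc.prems(2)]]
      by (intro Ck_on_sum[OF assms(1)] Ck_on_bilinear[OF bounded_bilinear_scaleR assms(1)]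
          Ck_on_linear_compose[OF bounded_linear_inner_left assms(1)]) auto
    show "(\<Sum>b\<in>Basis. (Dv g x v \<bullet> b) *\<^sub>R Dv f (g x) b) = Dv (\<lambda>x. f (g x)) x v" if "x \<in> S" for x
      unfolding Dv_eqI[OF d[OF that]]
      by (rule Dv_euclidean[symmetric]) (use Suc.prems assms(2) that in auto)
  qed
  with d show ?case by (auto simp: differentiable_def)
qed

lemma smooth_onD_differentiable: "smooth_on S f \<Longrightarrow> x \<in> S \<Longrightarrow> f differentiable (at x)"
  unfolding smooth_on_def by (metis Ck_on.simps(2))

lemma smooth_on_Dv: "smooth_on S f \<Longrightarrow> smooth_on S (\<lambda>x. Dv f x v)"
  unfolding smooth_on_def by (metis Ck_on.simps(2))

lemma smooth_on_imp_continuous_on: "smooth_on S f \<Longrightarrow> continuous_on S f"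
  unfolding smooth_on_def using Ck_on_imp_continuous_on by blast

lemma smooth_on_cong:
  "open S \<Longrightarrow> (\<And>x. x \<in> S \<Longrightarrow> f x = g x) \<Longrightarrow> smooth_on S f \<Longrightarrow> smooth_on S g"
  unfolding smooth_on_def by (metis Ck_on_cong)

lemma smooth_on_subset: "smooth_on S f \<Longrightarrow> T \<subseteq> S \<Longrightarrow> smooth_on T f"
  unfolding smooth_on_def by (metis Ck_on_subset)

lemma smooth_on_const: "smooth_on S (\<lambda>x. c)"
  unfolding smooth_on_def by (simp add: Ck_on_const)

lemma smooth_on_bounded_linear: "bounded_linear h \<Longrightarrow> smooth_on S h"
  unfolding smooth_on_def by (simp add: Ck_on_bounded_linear)

lemma smooth_on_linear_compose:
  "bounded_linear h \<Longrightarrow> open S \<Longrightarrow> smooth_on S f \<Longrightarrow> smooth_on S (\<lambda>x. h (f x))"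
  unfolding smooth_on_def by (simp add: Ck_on_linear_compose)

lemma smooth_on_add:
  "open S \<Longrightarrow> smooth_on S f \<Longrightarrow> smooth_on S g \<Longrightarrow> smooth_on S (\<lambda>x. f x + g x)"
  unfolding smooth_on_def by (simp add: Ck_on_add)

lemma smooth_on_scaleR:
  "open S \<Longrightarrow> smooth_on S f \<Longrightarrow> smooth_on S g \<Longrightarrow> smooth_on S (\<lambda>x. f x *\<^sub>R g x)"
  unfolding smooth_on_def by (simp add: Ck_on_bilinear[OF bounded_bilinear_scaleR])

lemma smooth_on_mult:
  fixes f g :: "'a::real_normed_vector \<Rightarrow> real"
  shows "open S \<Longrightarrow> smooth_on S f \<Longrightarrow> smooth_on S g \<Longrightarrow> smooth_on S (\<lambda>x. f x * g x)"
  unfolding smooth_on_def by (simp add: Ck_on_bilinear[OF bounded_bilinear_mult])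

lemma smooth_on_minus:
  "open S \<Longrightarrow> smooth_on S f \<Longrightarrow> smooth_on S (\<lambda>x. - f x)"
  by (rule smooth_on_linear_compose[OF bounded_linear_minus[OF bounded_linear_ident]])

lemma smooth_on_divide:
  fixes f g :: "'a::real_normed_vector \<Rightarrow> real"
  shows "open S \<Longrightarrow> smooth_on S f \<Longrightarrow> smooth_on S g \<Longrightarrow> (\<And>x. x \<in> S \<Longrightarrow> g x \<noteq> 0) \<Longrightarrow>
    smooth_on S (\<lambda>x. f x / g x)"
  unfolding smooth_on_def divide_inverse
  by (simp add: Ck_on_bilinear[OF bounded_bilinear_mult] Ck_on_inverse)

lemma smooth_on_compose:
  fixes f :: "'b::euclidean_space \<Rightarrow> 'c::real_normed_vector" and g :: "'a::real_normed_vector \<Rightarrow> 'b"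
  shows "open S \<Longrightarrow> g ` S \<subseteq> T \<Longrightarrow> smooth_on T f \<Longrightarrow> smooth_on S g \<Longrightarrow> smooth_on S (\<lambda>x. f (g x))"
  unfolding smooth_on_def using Ck_on_compose[of S g T _ f] by blast

lemma smooth_on_nth: "open S \<Longrightarrow> smooth_on S f \<Longrightarrow> smooth_on S (\<lambda>x. f x $ i)"
  by (rule smooth_on_linear_compose[OF bounded_linear_vec_nth])

section \<open>Derivatives along moving vectors and symmetry of second derivatives\<close>

lemma smooth_on_Dv_along:
  fixes f :: "'a::euclidean_space \<Rightarrow> 'b::real_normed_vector"
  assumes "open S" "smooth_on S f" "smooth_on S Y"
  shows "smooth_on S (\<lambda>r. Dv f r (Y r))"
proof (rule smooth_on_cong[OF assms(1)])
  show "smooth_on S (\<lambda>r. \<Sum>b\<in>Basis. (Y r \<bullet> b) *\<^sub>R Dv f r b)"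
    using assms smooth_on_Dv[OF assms(2)] unfolding smooth_on_def
    by (auto intro!: Ck_on_sum Ck_on_bilinear[OF bounded_bilinear_scaleR]
          Ck_on_linear_compose[OF bounded_linear_inner_left])
qed (metis Dv_euclidean assms(2) smooth_onD_differentiable)

text \<open>Product rule for a differential whose base point and argument both move. With
  \<open>g\<close> the identity it differentiates \<open>Y(f)\<close>; with \<open>g\<close> a curve
  and \<open>Y\<close> its velocity it gives the second-order terms of the geodesic
  equation.\<close>

lemma has_derivative_Dv_along:
  fixes f :: "'a::euclidean_space \<Rightarrow> 'b::real_normed_vector"
    and g Y :: "'c::real_normed_vector \<Rightarrow> 'a"
  assumes "open S" "smooth_on S f" "g x \<in> S" "(g has_derivative g') (at x)" "(Y has_derivative Y') (at x)"
  shows "((\<lambda>s. Dv f (g s) (Y s)) has_derivative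
    (\<lambda>h. Dv (\<lambda>r. Dv f r (Y x)) (g x) (g' h) + Dv f (g x) (Y' h))) (at x)"
proof -
  have c: "((\<lambda>s. Dv f (g s) b) has_derivative (\<lambda>h. Dv (\<lambda>r. Dv f r b) (g x) (g' h))) (at x)" for b
    using assms by (intro has_derivative_compose[OF assms(4)] has_derivative_Dv
        smooth_onD_differentiable[OF smooth_on_Dv])
  have "((\<lambda>s. \<Sum>b\<in>Basis. (Y s \<bullet> b) *\<^sub>R Dv f (g s) b) has_derivative
      (\<lambda>h. \<Sum>b\<in>Basis. (Y x \<bullet> b) *\<^sub>R Dv (\<lambda>r. Dv f r b) (g x) (g' h) + (Y' h \<bullet> b) *\<^sub>R Dv f (g x) b)) (at x)"
    using assms(5) by (intro has_derivative_sum has_derivative_scaleR c has_derivative_inner_left)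
  \<comment> \<open>With the argument frozen at \<open>Y x\<close>, the second-order terms
    reassemble into the derivative of one function.\<close>
  moreover have "(\<Sum>b\<in>Basis. (Y x \<bullet> b) *\<^sub>R Dv (\<lambda>r. Dv f r b) (g x) v) = Dv (\<lambda>r. Dv f r (Y x)) (g x) v" for v
  proof -
    have d: "((\<lambda>r. \<Sum>b\<in>Basis. (Y x \<bullet> b) *\<^sub>R Dv f r b) has_derivative
        (\<lambda>v. \<Sum>b\<in>Basis. (Y x \<bullet> b) *\<^sub>R Dv (\<lambda>r. Dv f r b) (g x) v)) (at (g x))"
      using assms by (intro has_derivative_sum has_derivative_scaleR_right has_derivative_Dv
          smooth_onD_differentiable[OF smooth_on_Dv])
    have "Dv (\<lambda>r. \<Sum>b\<in>Basis. (Y x \<bullet> b) *\<^sub>R Dv f r b) (g x) = Dv (\<lambda>r. Dv f r (Y x)) (g x)"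
      by (rule Dv_cong_open[OF assms(1,3)])
        (metis Dv_euclidean assms(2) smooth_onD_differentiable)
    then show ?thesis using fun_cong[OF Dv_eqI[OF d], of v] by simp
  qed
  moreover have "(\<Sum>b\<in>Basis. (Y' h \<bullet> b) *\<^sub>R Dv f (g x) b) = Dv f (g x) (Y' h)" for h
    by (rule Dv_euclidean[symmetric]) (use assms smooth_onD_differentiable in blast)
  ultimately have *: "((\<lambda>s. \<Sum>b\<in>Basis. (Y s \<bullet> b) *\<^sub>R Dv f (g s) b) has_derivative
    (\<lambda>h. Dv (\<lambda>r. Dv f r (Y x)) (g x) (g' h) + Dv f (g x) (Y' h))) (at x)"
    by (simp add: sum.distrib)
  have "eventually (\<lambda>s. g s \<in> S) (at x)"
    using has_derivative_continuous[OF assms(4)] assms(1,3)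
    by (simp add: continuous_within topological_tendstoD)
  then have "eventually (\<lambda>s. (\<Sum>b\<in>Basis. (Y s \<bullet> b) *\<^sub>R Dv f (g s) b) = Dv f (g s) (Y s)) (at x)"
    by eventually_elim (metis Dv_euclidean assms(2) smooth_onD_differentiable)
  moreover have "(\<Sum>b\<in>Basis. (Y x \<bullet> b) *\<^sub>R Dv f (g x) b) = Dv f (g x) (Y x)"
    by (metis Dv_euclidean assms(2,3) smooth_onD_differentiable)
  ultimately show ?thesis
    using has_derivative_transform_eventually[OF *] by simp
qed

text \<open>Two mean value theorems: one in direction \<open>u\<close> for the difference of
  \<open>f\<close> along two parallel segments, then one in direction \<open>v\<close> for the
  resulting derivative. The second difference itself is symmetric in \<open>u\<close> and
  \<open>v\<close>.\<close>

lemma second_difference_mean_value: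
  fixes f :: "'a::euclidean_space \<Rightarrow> real"
  assumes sm: "smooth_on S f" and h: "h > 0"
    and in_S: "\<And>a b. a \<in> {0..h} \<Longrightarrow> b \<in> {0..h} \<Longrightarrow> p + a *\<^sub>R u + b *\<^sub>R v \<in> S"
  obtains a b where "a \<in> {0..h}" "b \<in> {0..h}"
    "f (p + h *\<^sub>R u + h *\<^sub>R v) - f (p + h *\<^sub>R u) - f (p + h *\<^sub>R v) + f p =
      h\<^sup>2 * Dv (\<lambda>r. Dv f r u) (p + a *\<^sub>R u + b *\<^sub>R v) v"
proof -
  have line: "((\<lambda>s. g (q + s *\<^sub>R d)) has_real_derivative Dv g (q + s *\<^sub>R d) d) (at s)"
    if "g differentiable (at (q + s *\<^sub>R d))" for g :: "'a \<Rightarrow> real" and q d s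
  proof -
    have "((\<lambda>s. q + s *\<^sub>R d) has_derivative (\<lambda>x. x *\<^sub>R d)) (at s)"
      by (auto intro!: derivative_eq_intros)
    from has_derivative_compose[OF this has_derivative_Dv[OF that]]
    show ?thesis
      by (simp add: has_field_derivative_def linear_Dv[OF that] mult.commute[of _ "Dv g _ d"])
  qed
  have 1: "((\<lambda>s. f (p + h *\<^sub>R v + s *\<^sub>R u) - f (p + s *\<^sub>R u)) has_real_derivative
      Dv f (p + h *\<^sub>R v + a *\<^sub>R u) u - Dv f (p + a *\<^sub>R u) u) (at a)" if "a \<in> {0..h}" for a
  proof (intro derivative_intros line smooth_onD_differentiable[OF sm])
    show "p + h *\<^sub>R v + a *\<^sub>R u \<in> S" using in_S[OF that, of h] h by (simp add: add_ac)
    show "p + a *\<^sub>R u \<in> S" using in_S[OF that, of 0] h by simp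
  qed
  obtain a where a: "0 < a" "a < h"
    "(f (p + h *\<^sub>R v + h *\<^sub>R u) - f (p + h *\<^sub>R u)) - (f (p + h *\<^sub>R v + 0 *\<^sub>R u) - f (p + 0 *\<^sub>R u)) =
      (h - 0) * (Dv f (p + h *\<^sub>R v + a *\<^sub>R u) u - Dv f (p + a *\<^sub>R u) u)"
    using MVT2[OF h 1] by auto
  have 2: "((\<lambda>s. Dv f (p + a *\<^sub>R u + s *\<^sub>R v) u) has_real_derivative
      Dv (\<lambda>r. Dv f r u) (p + a *\<^sub>R u + b *\<^sub>R v) v) (at b)" if "b \<in> {0..h}" for b
    by (intro line[of "\<lambda>r. Dv f r u"] smooth_onD_differentiable[OF smooth_on_Dv[OF sm]] in_S)
      (use a that in auto)
  obtain b where b: "0 < b" "b < h"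
    "Dv f (p + a *\<^sub>R u + h *\<^sub>R v) u - Dv f (p + a *\<^sub>R u + 0 *\<^sub>R v) u =
      (h - 0) * Dv (\<lambda>r. Dv f r u) (p + a *\<^sub>R u + b *\<^sub>R v) v"
    using MVT2[OF h 2] by auto
  show thesis
    by (rule that[of a b]) (use a b in \<open>auto simp: power2_eq_square add_ac algebra_simps\<close>)
qed

text \<open>The same second difference, expanded in both orders, equates the two mixed derivatives
  at two points near \<open>p\<close>; continuity moves both points to \<open>p\<close>.\<close>

lemma Dv_Dv_commute:
  fixes f :: "'a::euclidean_space \<Rightarrow> real"
  assumes "open S" "smooth_on S f" "p \<in> S"
  shows "Dv (\<lambda>r. Dv f r u) p v = Dv (\<lambda>r. Dv f r v) p u"
proof -
  let ?A = "\<lambda>q. Dv (\<lambda>r. Dv f r u) q v" and ?B = "\<lambda>q. Dv (\<lambda>r. Dv f r v) q u"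
  have "\<bar>?A p - ?B p\<bar> \<le> \<epsilon>" if "\<epsilon> > 0" for \<epsilon> :: real
  proof -
    have near_limit: "\<forall>\<^sub>F q in nhds p. dist (g q) (g p) < \<epsilon>/2" if "smooth_on S g" for g :: "'a \<Rightarrow> real"
    proof -
      have "isCont g p"
        using smooth_on_imp_continuous_on[OF that] assms(1,3) by (simp add: continuous_on_eq_continuous_at)
      then have "(g \<longlongrightarrow> g p) (nhds p)"
        by (simp add: isCont_def tendsto_at_iff_tendsto_nhds)
      then show ?thesis using \<open>\<epsilon> > 0\<close> by (intro tendstoD) auto
    qed
    note A = near_limit[OF smooth_on_Dv[OF smooth_on_Dv[OF assms(2)]], of u v]
    note B = near_limit[OF smooth_on_Dv[OF smooth_on_Dv[OF assms(2)]], of v u]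
    have "\<forall>\<^sub>F q in nhds p. q \<in> S \<and> dist (?A q) (?A p) < \<epsilon>/2 \<and> dist (?B q) (?B p) < \<epsilon>/2"
      using eventually_nhds_in_open[OF assms(1,3)] A B by eventually_elim simp
    then obtain d where d: "d > 0" and d_S: "\<And>q. dist q p < d \<Longrightarrow> q \<in> S"
      and d_A: "\<And>q. dist q p < d \<Longrightarrow> dist (?A q) (?A p) < \<epsilon>/2"
      and d_B: "\<And>q. dist q p < d \<Longrightarrow> dist (?B q) (?B p) < \<epsilon>/2"
      unfolding eventually_nhds_metric by blast
    \<comment> \<open>The parallelogram with sides \<open>h *\<^sub>R u\<close> and
      \<open>h *\<^sub>R v\<close> stays in the ball of radius \<open>d\<close>; the summand 1 keeps
      the denominator positive when both vectors vanish.\<close>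
    define h where "h = d / (norm u + norm v + 1)"
    have pos: "norm u + norm v + 1 > 0" by (simp add: add_nonneg_pos)
    have h: "h > 0" using d pos by (simp add: h_def)
    have near: "dist (p + a *\<^sub>R u + b *\<^sub>R v) p < d" if "a \<in> {0..h}" "b \<in> {0..h}" for a b
    proof -
      have "dist (p + a *\<^sub>R u + b *\<^sub>R v) p = norm (a *\<^sub>R u + b *\<^sub>R v)"
        by (simp add: dist_norm)
      also have "\<dots> \<le> a * norm u + b * norm v"
        using norm_triangle_ineq[of "a *\<^sub>R u" "b *\<^sub>R v"] that by simp
      also have "\<dots> \<le> h * norm u + h * norm v"
        using that by (intro add_mono mult_right_mono) auto
      also have "\<dots> < h * (norm u + norm v + 1)"
        using h by (simp add: algebra_simps)
      also have "\<dots> = d" using pos by (simp add: h_def)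
      finally show ?thesis .
    qed
    have near': "dist (p + a *\<^sub>R v + b *\<^sub>R u) p < d" if "a \<in> {0..h}" "b \<in> {0..h}" for a b
      using near[OF that(2,1)] by (simp add: add_ac)
    obtain a b where 1: "a \<in> {0..h}" "b \<in> {0..h}"
      "f (p + h *\<^sub>R u + h *\<^sub>R v) - f (p + h *\<^sub>R u) - f (p + h *\<^sub>R v) + f p = h\<^sup>2 * ?A (p + a *\<^sub>R u + b *\<^sub>R v)"
      by (rule second_difference_mean_value[OF assms(2) h, of p u v])
        (blast intro: d_S near)+
    obtain a' b' where 2: "a' \<in> {0..h}" "b' \<in> {0..h}"
      "f (p + h *\<^sub>R v + h *\<^sub>R u) - f (p + h *\<^sub>R v) - f (p + h *\<^sub>R u) + f p = h\<^sup>2 * ?B (p + a' *\<^sub>R v + b' *\<^sub>R u)"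
      by (rule second_difference_mean_value[OF assms(2) h, of p v u])
        (blast intro: d_S near')+
    have "p + h *\<^sub>R v + h *\<^sub>R u = p + h *\<^sub>R u + h *\<^sub>R v"
      by (simp add: add_ac)
    note 2 = 2[unfolded this]
    have "h\<^sup>2 * ?A (p + a *\<^sub>R u + b *\<^sub>R v) = h\<^sup>2 * ?B (p + a' *\<^sub>R v + b' *\<^sub>R u)"
      unfolding 1(3)[symmetric] 2(3)[symmetric] by simp
    then have "?A (p + a *\<^sub>R u + b *\<^sub>R v) = ?B (p + a' *\<^sub>R v + b' *\<^sub>R u)"
      using h by simp
    moreover have "dist (?A (p + a *\<^sub>R u + b *\<^sub>R v)) (?A p) < \<epsilon>/2"
      by (intro d_A near 1)
    moreover have "dist (?B (p + a' *\<^sub>R v + b' *\<^sub>R u)) (?B p) < \<epsilon>/2"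
      by (intro d_B near' 2)
    ultimately show ?thesis
      unfolding dist_real_def by linarith
  qed
  then have "\<bar>?A p - ?B p\<bar> \<le> 0" by (rule field_le_epsilon) simp
  then show ?thesis by simp
qed

lemma smooth_on_dirderiv:
  "open S \<Longrightarrow> smooth_on S X \<Longrightarrow> smooth_on S f \<Longrightarrow> smooth_on S (dirderiv X f)"
  using smooth_on_Dv_along[of S f X] by (simp add: dirderiv_def[abs_def])

lemma dirderiv_dirderiv:
  assumes "open S" "p \<in> S" "smooth_on S f" "Y differentiable (at p)"
  shows "dirderiv X (dirderiv Y f) p = Dv (\<lambda>r. Dv f r (Y p)) p (X p) + Dv f p (Dv Y p (X p))"
  using Dv_eqI[OF has_derivative_Dv_along[OF assms(1,3) _ has_derivative_ident has_derivative_Dv[OF assms(4)]]] assms(2)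
  by (simp add: dirderiv_def[abs_def])

text \<open>The two iterated derivatives contain the Hessian of \<open>f\<close> on the same pair of
  vectors. These terms cancel by symmetry, leaving the first-order ones.\<close>

lemma dirderiv_lie_bracket:
  fixes f :: "real^2 \<Rightarrow> real"
  assumes "open S" "p \<in> S" "smooth_on S f" "X differentiable (at p)" "Y differentiable (at p)"
  shows "dirderiv X (dirderiv Y f) p - dirderiv Y (dirderiv X f) p = Dv f p (lie_bracket X Y p)"
  using Dv_Dv_commute[OF assms(1,3,2), of "Y p" "X p"]
  by (simp add: dirderiv_dirderiv[OF assms(1-3)] assms(4,5) lie_bracket_def
      linear_Dv[OF smooth_onD_differentiable[OF assms(3,2)]]) (simp add: dirderiv_def)

section \<open>Coordinate frames\<close>

lemma dirderiv_cong_open: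
  "open S \<Longrightarrow> q \<in> S \<Longrightarrow> (\<And>y. y \<in> S \<Longrightarrow> f y = g y) \<Longrightarrow> dirderiv X f q = dirderiv X g q"
  unfolding dirderiv_def using Dv_cong_open[of S q f g] by simp

lemma dirderiv_add:
  "f differentiable (at q) \<Longrightarrow> g differentiable (at q) \<Longrightarrow>
    dirderiv X (\<lambda>r. f r + g r) q = dirderiv X f q + dirderiv X g q"
  using Dv_eqI[OF has_derivative_add[OF has_derivative_Dv has_derivative_Dv], of f q g]
  by (simp add: dirderiv_def)

lemma dirderiv_mult:
  fixes f g :: "real^2 \<Rightarrow> real"
  shows "f differentiable (at q) \<Longrightarrow> g differentiable (at q) \<Longrightarrow>
    dirderiv X (\<lambda>r. f r * g r) q = dirderiv X f q * g q + f q * dirderiv X g q"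
  using Dv_eqI[OF has_derivative_mult[OF has_derivative_Dv has_derivative_Dv], of f q g]
  by (simp add: dirderiv_def)

lemma dirderiv_divide:
  fixes f g :: "real^2 \<Rightarrow> real"
  assumes "f differentiable (at q)" "g differentiable (at q)" "g q \<noteq> 0"
  shows "dirderiv X (\<lambda>r. f r / g r) q = (dirderiv X f q * g q - f q * dirderiv X g q) / (g q * g q)"
  using Dv_eqI[OF has_derivative_divide'[OF has_derivative_Dv[OF assms(1)] has_derivative_Dv[OF assms(2)] assms(3)]]
  by (simp add: dirderiv_def)

lemma dirderiv_minus:
  "f differentiable (at q) \<Longrightarrow> dirderiv X (\<lambda>r. - f r) q = - dirderiv X f q"
  using Dv_eqI[OF has_derivative_minus[OF has_derivative_Dv], of f q]
  by (simp add: dirderiv_def)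

section \<open>The coordinate frame of a chart\<close>

locale plane_chart =
  fixes U :: "(real^2) set" and \<phi> :: "real^2 \<Rightarrow> real^2"
  assumes chart: "smooth_chart U \<phi>"
begin

abbreviation E :: "2 \<Rightarrow> vfield" where "E \<equiv> coord_field U \<phi>"
abbreviation P :: "2 \<Rightarrow> (real^2 \<Rightarrow> real) \<Rightarrow> real^2 \<Rightarrow> real" where "P k \<equiv> dirderiv (E k)"
abbreviation cmp :: "vfield \<Rightarrow> 2 \<Rightarrow> real^2 \<Rightarrow> real" where "cmp Z k \<equiv> dirderiv Z (\<lambda>p. \<phi> p $ k)"

lemma open_U: "open U" and open_image: "open (\<phi> ` U)" and smooth_chart_map: "smooth_on U \<phi>"
  and smooth_inv: "smooth_on (\<phi> ` U) (inv_into U \<phi>)" and inj: "inj_on \<phi> U"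
  using chart unfolding smooth_chart_def by auto

lemma smooth_coord: "smooth_on U (\<lambda>r. \<phi> r $ k)"
  by (rule smooth_on_nth[OF open_U smooth_chart_map])

lemma Dv_coord: "q \<in> U \<Longrightarrow> Dv (\<lambda>r. \<phi> r $ k) q v = Dv \<phi> q v $ k"
  using Dv_eqI[OF bounded_linear.has_derivative[OF bounded_linear_vec_nth has_derivative_Dv]]
    smooth_onD_differentiable[OF smooth_chart_map] by metis

text \<open>Differentiate the two identities between the chart and its inverse, each of which holds
  on an open set.\<close>

lemma Dv_chart_inverse:
  assumes "q \<in> U"
  shows "Dv \<phi> q (Dv (inv_into U \<phi>) (\<phi> q) v) = v" "Dv (inv_into U \<phi>) (\<phi> q) (Dv \<phi> q v) = v"
proof -
  have d1: "(\<phi> has_derivative Dv \<phi> q) (at q)"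
    by (rule has_derivative_Dv[OF smooth_onD_differentiable[OF smooth_chart_map assms]])
  have d2: "(inv_into U \<phi> has_derivative Dv (inv_into U \<phi>) (\<phi> q)) (at (\<phi> q))"
    using assms by (intro has_derivative_Dv smooth_onD_differentiable[OF smooth_inv]) simp
  have inv_q: "inv_into U \<phi> (\<phi> q) = q" using assms inj by simp
  have "Dv (\<lambda>r. inv_into U \<phi> (\<phi> r)) q = Dv (\<lambda>r. r) q"
    by (rule Dv_cong_open[OF open_U assms]) (simp add: inj)
  with Dv_eqI[OF has_derivative_compose[OF d1 d2]]
  show "Dv (inv_into U \<phi>) (\<phi> q) (Dv \<phi> q v) = v" by (simp add: fun_eq_iff)
  have "Dv (\<lambda>r. \<phi> (inv_into U \<phi> r)) (\<phi> q) = Dv (\<lambda>r. r) (\<phi> q)"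
    by (rule Dv_cong_open[OF open_image]) (use assms f_inv_into_f[of _ \<phi> U] in auto)
  with Dv_eqI[OF has_derivative_compose[OF d2, of \<phi> "Dv \<phi> q"]] d1 inv_q
  show "Dv \<phi> q (Dv (inv_into U \<phi>) (\<phi> q) v) = v" by (simp add: fun_eq_iff)
qed

lemma Dv_coord_E: "q \<in> U \<Longrightarrow> Dv (\<lambda>r. \<phi> r $ k) q (E j q) = (if k = j then 1 else 0)"
  by (simp add: Dv_coord coord_field_def Dv_chart_inverse axis_def)

lemma frame_expansion:
  assumes "q \<in> U"
  shows "v = Dv (\<lambda>r. \<phi> r $ 1) q v *\<^sub>R E 1 q + Dv (\<lambda>r. \<phi> r $ 2) q v *\<^sub>R E 2 q"
proof -
  have d: "inv_into U \<phi> differentiable (at (\<phi> q))"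
    using assms by (intro smooth_onD_differentiable[OF smooth_inv]) simp
  have "x = x $ 1 *\<^sub>R axis 1 1 + x $ 2 *\<^sub>R axis 2 1" for x :: "real^2"
    by (simp add: vec_eq_iff forall_2 axis_def)
  from arg_cong[OF this[of "Dv \<phi> q v"], of "Dv (inv_into U \<phi>) (\<phi> q)"]
  show ?thesis
    by (simp add: linear_Dv[OF d] Dv_chart_inverse[OF assms] Dv_coord[OF assms] coord_field_def)
qed

lemma Dv_frame:
  fixes f :: "real^2 \<Rightarrow> real"
  assumes "q \<in> U" "f differentiable (at q)"
  shows "Dv f q v = Dv (\<lambda>r. \<phi> r $ 1) q v * P 1 f q + Dv (\<lambda>r. \<phi> r $ 2) q v * P 2 f q"
  by (subst frame_expansion[OF assms(1), of v]) (simp add: linear_Dv[OF assms(2)] dirderiv_def)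

lemma dirderiv_frame:
  fixes f :: "real^2 \<Rightarrow> real"
  assumes "q \<in> U" "f differentiable (at q)"
  shows "dirderiv X f q = cmp X 1 q * P 1 f q + cmp X 2 q * P 2 f q"
  unfolding dirderiv_def[of X] by (rule Dv_frame[OF assms])

lemma smooth_E: "smooth_on U (E k)"
proof -
  have "smooth_on U (\<lambda>q. Dv (inv_into U \<phi>) (\<phi> q) (axis k 1))"
    by (rule smooth_on_compose[OF open_U subset_refl smooth_on_Dv[OF smooth_inv] smooth_chart_map])
  then show ?thesis by (simp add: coord_field_def[abs_def])
qed

lemma smooth_P: "smooth_on U f \<Longrightarrow> smooth_on U (P k f)"
  by (rule smooth_on_dirderiv[OF open_U smooth_E])

lemma smooth_cmp: "smooth_on U X \<Longrightarrow> smooth_on U (cmp X k)"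
  by (rule smooth_on_dirderiv[OF open_U _ smooth_coord])

lemma P_coord: "q \<in> U \<Longrightarrow> P k (\<lambda>r. \<phi> r $ j) q = (if j = k then 1 else 0)"
  unfolding dirderiv_def by (rule Dv_coord_E)

text \<open>The coordinates have constant derivatives along the frame, so the commutator annihilates
  both of them, and a vector killed by both differentials is zero.\<close>

lemma lie_bracket_E:
  assumes "q \<in> U"
  shows "lie_bracket (E i) (E j) q = 0"
proof -
  have "P i (P j (\<lambda>r. \<phi> r $ k)) q = 0" for i j k
  proof -
    have "P i (P j (\<lambda>r. \<phi> r $ k)) q = P i (\<lambda>r. if k = j then 1 else 0) q"
      by (rule dirderiv_cong_open[OF open_U assms]) (simp add: P_coord)
    then show ?thesis by (simp add: dirderiv_def)
  qed
  then have "Dv (\<lambda>r. \<phi> r $ k) q (lie_bracket (E i) (E j) q) = 0" for k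
    using dirderiv_lie_bracket[OF open_U assms smooth_coord, of "E i" "E j" k]
      smooth_onD_differentiable[OF smooth_E assms] by simp
  then show ?thesis
    by (subst frame_expansion[OF assms]) simp
qed

text \<open>\<open>S\<close> is kept apart from the chart domain because functions coming from a
  second chart are smooth only on the overlap.\<close>

lemma P_commute:
  assumes "open S" "smooth_on S f" "q \<in> S" "q \<in> U"
  shows "P i (P j f) q = P j (P i f) q"
  using dirderiv_lie_bracket[OF assms(1,3,2), of "E i" "E j"]
    smooth_onD_differentiable[OF smooth_E assms(4)] lie_bracket_E[OF assms(4)]
    linear_Dv(4)[OF smooth_onD_differentiable[OF assms(2,3)]] by simp

lemma frame_eqI:
  assumes "q \<in> U" "\<And>k. Dv (\<lambda>r. \<phi> r $ k) q v = Dv (\<lambda>r. \<phi> r $ k) q v'"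
  shows "v = v'"
  using frame_expansion[OF assms(1), of v] frame_expansion[OF assms(1), of v'] assms(2) by simp

end

section \<open>The local connection of a function \<open>w\<close> in fixed coordinates\<close>

locale web_coords = plane_chart +
  fixes w :: "real^2 \<Rightarrow> real"
  assumes smooth_w: "smooth_on U w"
    and P_w_nonzero: "q \<in> U \<Longrightarrow> P 1 w q \<noteq> 0" "q \<in> U \<Longrightarrow> P 2 w q \<noteq> 0"
begin

definition slope :: "real^2 \<Rightarrow> real" where
  "slope q = P 1 w q / P 2 w q"

text \<open>The connection only depends on \<open>w\<close> through the slope \<open>r = w\<^sub>x / w\<^sub>y\<close>: its two coefficients
  are the logarithmic derivatives \<open>(ln r)\<^sub>x\<close> and \<open>- (ln r)\<^sub>y\<close>.\<close>

definition G :: "2 \<Rightarrow> real^2 \<Rightarrow> real" where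
  "G k q = (if k = 1 then P 1 slope q else - P 2 slope q) / slope q"

lemma slope_nonzero: "q \<in> U \<Longrightarrow> slope q \<noteq> 0"
  using P_w_nonzero by (simp add: slope_def)

lemma smooth_slope: "smooth_on U slope"
  unfolding slope_def[abs_def]
  by (intro smooth_on_divide open_U smooth_P smooth_w P_w_nonzero)

lemma smooth_G: "smooth_on U (G k)"
proof (cases "k = 1")
  case True
  then show ?thesis unfolding G_def[abs_def]
    by (auto intro!: smooth_on_divide open_U smooth_P smooth_slope slope_nonzero)
next
  case False
  then show ?thesis unfolding G_def[abs_def]
    by (auto intro!: smooth_on_divide smooth_on_minus[OF open_U] open_U smooth_P smooth_slope slope_nonzero)
qed

lemma P_slope:
  assumes "q \<in> U"
  shows "P k slope q = (P k (P 1 w) q * P 2 w q - P 1 w q * P k (P 2 w) q) / (P 2 w q * P 2 w q)"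
  unfolding slope_def[abs_def]
  by (intro dirderiv_divide smooth_onD_differentiable[OF smooth_P[OF smooth_w]] assms P_w_nonzero)

text \<open>Quotient rule for w_x / w_y. The definition takes the y-derivative of w_x as mixed
  derivative, whereas (ln r)_x produces the x-derivative of w_y; \<open>P_commute\<close> reconciles
  them.\<close>

lemma christoffel_eq:
  assumes "q \<in> U"
  shows "christoffel U \<phi> w k i j q = (if i = k \<and> j = k then G k q else 0)"
proof -
  have "k = 1 \<or> k = 2" by (rule exhaust_2)
  then show ?thesis
    using P_w_nonzero[OF assms] P_commute[OF open_U smooth_w assms assms, of 1 2]
    by (auto simp: christoffel_def Let_def G_def P_slope[OF assms] slope_def field_simps)
qed

lemma local_connection_eq:
  assumes "q \<in> U"
  shows "local_connection U \<phi> w X Y q =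
    (\<Sum>k\<in>UNIV. (dirderiv X (cmp Y k) q + G k q * cmp X k q * cmp Y k q) *\<^sub>R E k q)"
  by (simp add: local_connection_def Let_def christoffel_eq[OF assms] sum_2)

text \<open>The component form in which torsion, curvature and acceleration are computed; different
  components do not mix in the quadratic term.\<close>

lemma Dv_coord_local_connection:
  assumes "q \<in> U"
  shows "Dv (\<lambda>r. \<phi> r $ k) q (local_connection U \<phi> w X Y q) =
    dirderiv X (cmp Y k) q + G k q * cmp X k q * cmp Y k q"
proof -
  have "k = 1 \<or> k = 2" by (rule exhaust_2)
  then show ?thesis
    by (auto simp: local_connection_eq[OF assms] sum_2 Dv_coord_E[OF assms]
        linear_Dv[OF smooth_onD_differentiable[OF smooth_coord assms]])
qed

text \<open>Both sides are minus the mixed second derivative of ln r. This link between the two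
  coefficients makes the curvature act by the same scalar on both frame directions.\<close>

lemma P_G:
  assumes "q \<in> U"
  shows "P 1 (G 2) q = - P 2 (G 1) q"
proof -
  note d = smooth_onD_differentiable[OF smooth_slope assms]
    smooth_onD_differentiable[OF smooth_P[OF smooth_slope] assms]
  have "P 1 (G 2) q = - ((P 1 (P 2 slope) q * slope q - P 2 slope q * P 1 slope q) / (slope q * slope q))"
    unfolding G_def[abs_def] using slope_nonzero[OF assms]
    by (simp add: dirderiv_divide differentiable_minus dirderiv_minus d)
  moreover have "P 2 (G 1) q = (P 2 (P 1 slope) q * slope q - P 1 slope q * P 2 slope q) / (slope q * slope q)"
    unfolding G_def[abs_def] using slope_nonzero[OF assms]
    by (simp add: dirderiv_divide d)
  ultimately show ?thesis
    using P_commute[OF open_U smooth_slope assms assms, of 1 2] by (simp add: mult.commute)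
qed

section \<open>Torsion, curvature and Ricci tensor in coordinates\<close>

lemma torsion_local_connection:
  assumes "q \<in> U" "smooth_on U X" "smooth_on U Y"
  shows "local_connection U \<phi> w X Y q - local_connection U \<phi> w Y X q = lie_bracket X Y q"
proof (rule frame_eqI[OF assms(1)])
  fix k
  \<comment> \<open>The term with \<open>G k\<close> is symmetric in \<open>X\<close> and
    \<open>Y\<close>; what remains is the commutator applied to a coordinate.\<close>
  show "Dv (\<lambda>r. \<phi> r $ k) q (local_connection U \<phi> w X Y q - local_connection U \<phi> w Y X q) =
      Dv (\<lambda>r. \<phi> r $ k) q (lie_bracket X Y q)"
    using dirderiv_lie_bracket[OF open_U assms(1) smooth_coord, of X Y k]
      smooth_onD_differentiable[OF assms(2,1)] smooth_onD_differentiable[OF assms(3,1)]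
    by (simp add: linear_Dv[OF smooth_onD_differentiable[OF smooth_coord assms(1)]]
        Dv_coord_local_connection[OF assms(1)])
qed

text \<open>The field \<open>nab Y Z\<close> gets differentiated, so its formula is needed
  throughout \<open>U\<close>, which is \<open>nab\<close>. The outer application acts at
  \<open>p\<close> on that field, whose smoothness is unknown, hence \<open>nab_p\<close> for
  arbitrary fields.\<close>

lemma curvature_eq:
  assumes p: "p \<in> U" and smooth: "smooth_on U X" "smooth_on U Y" "smooth_on U Z"
    and nab: "\<And>V W q. q \<in> U \<Longrightarrow> smooth_on UNIV W \<Longrightarrow> nab V W q = local_connection U \<phi> w V W q"
    and nab_p: "\<And>V W. nab V W p = local_connection U \<phi> w V W p"
    and Z: "smooth_on UNIV Z"
  shows "curvature nab X Y Z p =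
    (P 2 (G 1) p * (cmp X 2 p * cmp Y 1 p - cmp X 1 p * cmp Y 2 p)) *\<^sub>R Z p"
proof (rule frame_eqI[OF p])
  fix k
  note diff = smooth_onD_differentiable[OF _ p]
  have second: "dirderiv V (cmp (nab W Z) k) p = dirderiv V (dirderiv W (cmp Z k)) p +
      ((cmp V 1 p * P 1 (G k) p + cmp V 2 p * P 2 (G k) p) * cmp W k p + G k p * dirderiv V (cmp W k) p) * cmp Z k p
        + G k p * cmp W k p * dirderiv V (cmp Z k) p"
    if "smooth_on U V" "smooth_on U W" for V W
  proof -
    have s: "smooth_on U (dirderiv W (cmp Z k))" "smooth_on U (\<lambda>q. G k q * cmp W k q)"
      by (intro smooth_on_dirderiv smooth_on_mult smooth_G smooth_cmp open_U that smooth)+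
    have "dirderiv V (cmp (nab W Z) k) p =
        dirderiv V (\<lambda>q. dirderiv W (cmp Z k) q + G k q * cmp W k q * cmp Z k q) p"
      by (rule dirderiv_cong_open[OF open_U p])
        (simp add: dirderiv_def[of "nab W Z"] nab[OF _ Z] Dv_coord_local_connection)
    also have "\<dots> = dirderiv V (dirderiv W (cmp Z k)) p +
       ((dirderiv V (G k) p * cmp W k p + G k p * dirderiv V (cmp W k) p) * cmp Z k p
        + G k p * cmp W k p * dirderiv V (cmp Z k) p)"
      using diff[OF s(1)] diff[OF s(2)] diff[OF smooth_G, of k] diff[OF smooth_cmp[OF that(2)], of k]
        diff[OF smooth_cmp[OF smooth(3)], of k]
      by (simp add: dirderiv_add dirderiv_mult)
    finally show ?thesis
      by (simp add: dirderiv_frame[OF p diff[OF smooth_G], of V k])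
  qed
  have bracket: "dirderiv X (dirderiv Y f) p - dirderiv Y (dirderiv X f) p = dirderiv (lie_bracket X Y) f p"
    if "smooth_on U f" for f :: "real^2 \<Rightarrow> real"
    using dirderiv_lie_bracket[OF open_U p that diff[OF smooth(1)] diff[OF smooth(2)]]
    by (simp add: dirderiv_def[of "lie_bracket X Y"])
  have nab_cmp: "Dv (\<lambda>r. \<phi> r $ k) p (nab V W p) = dirderiv V (cmp W k) p + G k p * cmp V k p * cmp W k p"
    for V W unfolding nab_p by (rule Dv_coord_local_connection[OF p])
  have nab_cmp': "cmp (nab V W) k p = dirderiv V (cmp W k) p + G k p * cmp V k p * cmp W k p"
    for V W using nab_cmp by (simp add: dirderiv_def[of "nab V W"])
  note linear = linear_Dv[OF diff[OF smooth_coord]]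
  have "k = 1 \<or> k = 2" by (rule exhaust_2)
  \<comment> \<open>For each \<open>k\<close> the derivative of \<open>G k\<close> in its own
    direction \<open>k\<close> cancels. The other derivative survives, and \<open>P_G\<close> gives
    it the same coefficient for both values of \<open>k\<close>.\<close>
  then have "((cmp X 1 p * P 1 (G k) p + cmp X 2 p * P 2 (G k) p) * cmp Y k p -
      (cmp Y 1 p * P 1 (G k) p + cmp Y 2 p * P 2 (G k) p) * cmp X k p) =
      P 2 (G 1) p * (cmp X 2 p * cmp Y 1 p - cmp X 1 p * cmp Y 2 p)"
    using P_G[OF p] by (auto simp: algebra_simps)
  \<comment> \<open>Terms symmetric in \<open>X\<close> and \<open>Y\<close> drop out and the
    bracket absorbs the commutators, so only derivatives of \<open>G k\<close> are left.\<close>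
  moreover have "Dv (\<lambda>r. \<phi> r $ k) p (curvature nab X Y Z p) =
      ((cmp X 1 p * P 1 (G k) p + cmp X 2 p * P 2 (G k) p) * cmp Y k p -
      (cmp Y 1 p * P 1 (G k) p + cmp Y 2 p * P 2 (G k) p) * cmp X k p) * cmp Z k p"
    unfolding curvature_def linear nab_cmp second[OF smooth(1,2)] second[OF smooth(2,1)] nab_cmp'
      bracket[OF smooth_coord, symmetric] bracket[OF smooth_cmp[OF smooth(3)], symmetric]
    by (simp add: algebra_simps)
  ultimately show "Dv (\<lambda>r. \<phi> r $ k) p (curvature nab X Y Z p) = Dv (\<lambda>r. \<phi> r $ k) p
      ((P 2 (G 1) p * (cmp X 2 p * cmp Y 1 p - cmp X 1 p * cmp Y 2 p)) *\<^sub>R Z p)"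
    by (simp add: linear dirderiv_def[of Z])
qed

text \<open>As a function of its first argument the curvature has the form \<lambda>(v) Z with a
  linear functional \<lambda>, and the trace of such a map is \<lambda>(Z).\<close>

lemma ricci_eq:
  assumes p: "p \<in> U" and Y: "smooth_on UNIV Y" and Z: "smooth_on UNIV Z"
    and nab: "\<And>V W q. q \<in> U \<Longrightarrow> smooth_on UNIV W \<Longrightarrow> nab V W q = local_connection U \<phi> w V W q"
    and nab_p: "\<And>V W. nab V W p = local_connection U \<phi> w V W p"
  shows "ricci nab Y Z p = P 2 (G 1) p * (cmp Z 2 p * cmp Y 1 p - cmp Z 1 p * cmp Y 2 p)"
proof -
  let ?d = "\<lambda>k. Dv (\<lambda>r. \<phi> r $ k) p"
  have curv: "curvature nab (\<lambda>_. v) Y Z p =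
      (P 2 (G 1) p * (?d 2 v * cmp Y 1 p - ?d 1 v * cmp Y 2 p)) *\<^sub>R Z p" for v
    using curvature_eq[OF p smooth_on_const smooth_on_subset[OF Y] smooth_on_subset[OF Z] nab nab_p Z, of v]
    by (simp add: dirderiv_def[of "\<lambda>_. v"])
  \<comment> \<open>\<open>trace\<close> sums over the standard basis, so the components of
    \<open>Z\<close> in the chart are written in terms of its standard ones.\<close>
  have Z_expand: "cmp Z k p = Z p $ 1 * ?d k (axis 1 1) + Z p $ 2 * ?d k (axis 2 1)" for k
  proof -
    have "Z p = Z p $ 1 *\<^sub>R axis 1 1 + Z p $ 2 *\<^sub>R axis 2 1"
      by (simp add: vec_eq_iff forall_2 axis_def)
    from arg_cong[OF this, of "?d k"] show ?thesis
      by (simp add: linear_Dv[OF smooth_onD_differentiable[OF smooth_coord p]] dirderiv_def)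
  qed
  show ?thesis
    unfolding ricci_def trace_def matrix_def curv Z_expand by (simp add: sum_2 algebra_simps)
qed

text \<open>Being parallel in the plane is the vanishing of one determinant, here
  \<open>A 1 * u 2 \<tau> - A 2 * u 1 \<tau>\<close> with \<open>u\<close> and \<open>A\<close> the
  frame components of velocity and acceleration. The tangency relation \<open>web\<close> is assumed
  along the whole part of the curve in \<open>U\<close> so that it can be differentiated at
  \<open>\<tau>\<close>.\<close>

lemma geodesic_equation:
  assumes smooth: "smooth_on {a<..<b} \<gamma>" and \<tau>: "\<tau> \<in> {a<..<b}" and p: "\<gamma> \<tau> \<in> U"
    and nab_p: "\<And>V W. nab V W (\<gamma> \<tau>) = local_connection U \<phi> w V W (\<gamma> \<tau>)"
    and t\<^sub>0: "t\<^sub>0 \<noteq> 0"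
    and nonzero: "vector_derivative \<gamma> (at \<tau>) \<noteq> 0"
    and web: "\<And>\<sigma>. \<sigma> \<in> {a<..<b} \<Longrightarrow> \<gamma> \<sigma> \<in> U \<Longrightarrow>
      t\<^sub>0 * slope (\<gamma> \<sigma>) * Dv (\<lambda>r. \<phi> r $ 1) (\<gamma> \<sigma>) (vector_derivative \<gamma> (at \<sigma>)) +
      t * Dv (\<lambda>r. \<phi> r $ 2) (\<gamma> \<sigma>) (vector_derivative \<gamma> (at \<sigma>)) = 0"
  shows "\<exists>c. acceleration nab \<gamma> \<tau> = c *\<^sub>R vector_derivative \<gamma> (at \<tau>)"
proof -
  define v where "v = (\<lambda>\<sigma>. vector_derivative \<gamma> (at \<sigma>))"
  define u where "u = (\<lambda>k \<sigma>. Dv (\<lambda>r. \<phi> r $ k) (\<gamma> \<sigma>) (v \<sigma>))"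
  define v' where "v' = vector_derivative v (at \<tau>)"
  \<comment> \<open>The derivative of \<open>u k\<close> at \<open>\<tau>\<close>: the first summand
    comes from the moving base point, the second from the changing velocity.\<close>
  define u' where "u' = (\<lambda>k. Dv (\<lambda>r. Dv (\<lambda>r. \<phi> r $ k) r (v \<tau>)) (\<gamma> \<tau>) (v \<tau>) + Dv (\<lambda>r. \<phi> r $ k) (\<gamma> \<tau>) v')"
  define A where "A = (\<lambda>k. u' k + G k (\<gamma> \<tau>) * (u k \<tau>)\<^sup>2)"
  note diff = smooth_onD_differentiable[OF _ p]
  have v_eq: "v \<sigma> = Dv \<gamma> \<sigma> 1" if "\<sigma> \<in> {a<..<b}" for \<sigma>
    using frechet_derivative_eq_vector_derivative[OF smooth_onD_differentiable[OF smooth that]]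
    by (simp add: v_def)
  have \<gamma>: "(\<gamma> has_derivative (\<lambda>h. h *\<^sub>R v \<tau>)) (at \<tau>)"
    using has_derivative_Dv[OF smooth_onD_differentiable[OF smooth \<tau>]]
      frechet_derivative_eq_vector_derivative[OF smooth_onD_differentiable[OF smooth \<tau>]]
    by (simp add: v_def)
  have "smooth_on {a<..<b} v"
    by (rule smooth_on_cong[OF _ _ smooth_on_Dv[OF smooth, of 1]]) (simp_all add: v_eq)
  from smooth_onD_differentiable[OF this \<tau>] have v: "(v has_derivative (\<lambda>h. h *\<^sub>R v')) (at \<tau>)"
    using frechet_derivative_eq_vector_derivative[of v \<tau>] has_derivative_Dv[of v \<tau>] by (simp add: v'_def)
  have u: "(u k has_real_derivative u' k) (at \<tau>)" for k
  proof -
    note Dv_scale = linear_Dv(2)[OF diff[OF smooth_on_Dv[OF smooth_coord]]] linear_Dv(2)[OF diff[OF smooth_coord]]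
    have "(u k has_derivative (\<lambda>h. h * u' k)) (at \<tau>)"
      using has_derivative_Dv_along[OF open_U smooth_coord[of k] p \<gamma> v]
      by (simp add: Dv_scale u_def u'_def algebra_simps)
    then show ?thesis
      by (simp add: has_field_derivative_def mult.commute[of _ "u' k"])
  qed
  \<comment> \<open>The velocity enters \<open>nab\<close> as a constant field, but its components
    in the chart are not constant. Their derivative is exactly the first summand of
    \<open>u' k\<close>, so the standard second derivative is corrected to that of
    \<open>u k\<close>.\<close>
  have accel: "Dv (\<lambda>r. \<phi> r $ k) (\<gamma> \<tau>) (acceleration nab \<gamma> \<tau>) = A k" for k
    unfolding acceleration_def Let_def nab_p linear_Dv[OF diff[OF smooth_coord]]
      Dv_coord_local_connection[OF p]
    by (simp add: A_def u'_def u_def v_def v'_def dirderiv_def[abs_def] power2_eq_square)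
  have slope_\<gamma>: "((\<lambda>\<sigma>. slope (\<gamma> \<sigma>)) has_real_derivative
      u 1 \<tau> * P 1 slope (\<gamma> \<tau>) + u 2 \<tau> * P 2 slope (\<gamma> \<tau>)) (at \<tau>)"
  proof -
    have "((\<lambda>\<sigma>. slope (\<gamma> \<sigma>)) has_derivative
        (\<lambda>h. h * (u 1 \<tau> * P 1 slope (\<gamma> \<tau>) + u 2 \<tau> * P 2 slope (\<gamma> \<tau>)))) (at \<tau>)"
      using has_derivative_compose[OF \<gamma> has_derivative_Dv[OF diff[OF smooth_slope]]]
      by (simp add: linear_Dv(2)[OF diff[OF smooth_slope]] Dv_frame[OF p diff[OF smooth_slope], of "v \<tau>"] u_def)
    then show ?thesis
      by (rule has_derivative_imp_has_field_derivative) simp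
  qed
  \<comment> \<open>The curve may leave \<open>U\<close>, but it stays there for parameters near
    \<open>\<tau>\<close>, and that is enough to differentiate the relation.\<close>
  have ev: "\<forall>\<^sub>F \<sigma> in nhds \<tau>. t\<^sub>0 * slope (\<gamma> \<sigma>) * u 1 \<sigma> + t * u 2 \<sigma> = 0"
  proof -
    have "isCont \<gamma> \<tau>" using \<gamma> has_derivative_continuous by blast
    then have "\<forall>\<^sub>F \<sigma> in nhds \<tau>. \<gamma> \<sigma> \<in> U"
      using open_U p by (simp add: isCont_def tendsto_at_iff_tendsto_nhds topological_tendstoD)
    moreover have "\<forall>\<^sub>F \<sigma> in nhds \<tau>. \<sigma> \<in> {a<..<b}"
      using \<tau> by (intro eventually_nhds_in_open) auto
    ultimately show ?thesis
      by eventually_elim (use web in \<open>simp add: u_def v_def\<close>)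
  qed
  then have rel: "t\<^sub>0 * slope (\<gamma> \<tau>) * u 1 \<tau> + t * u 2 \<tau> = 0"
    by (rule eventually_nhds_x_imp_x)
  have "((\<lambda>\<sigma>. t\<^sub>0 * slope (\<gamma> \<sigma>) * u 1 \<sigma> + t * u 2 \<sigma>) has_real_derivative
      t\<^sub>0 * ((u 1 \<tau> * P 1 slope (\<gamma> \<tau>) + u 2 \<tau> * P 2 slope (\<gamma> \<tau>)) * u 1 \<tau> + slope (\<gamma> \<tau>) * u' 1) + t * u' 2) (at \<tau>)"
    by (auto intro!: derivative_eq_intros slope_\<gamma> u simp: algebra_simps)
  moreover have "((\<lambda>\<sigma>. t\<^sub>0 * slope (\<gamma> \<sigma>) * u 1 \<sigma> + t * u 2 \<sigma>) has_real_derivative 0) (at \<tau>)"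
    using DERIV_cong_ev[OF refl ev refl, of 0] by simp
  ultimately have rel': "t\<^sub>0 * ((u 1 \<tau> * P 1 slope (\<gamma> \<tau>) + u 2 \<tau> * P 2 slope (\<gamma> \<tau>)) * u 1 \<tau> +
      slope (\<gamma> \<tau>) * u' 1) + t * u' 2 = 0"
    by (rule DERIV_unique)
  have parallel: "A 1 * u 2 \<tau> = A 2 * u 1 \<tau>"
  proof (cases "t = 0")
    case True
    with rel t\<^sub>0 slope_nonzero[OF p] have "u 1 \<tau> = 0" by simp
    with rel' True t\<^sub>0 slope_nonzero[OF p] have "u' 1 = 0" by simp
    with \<open>u 1 \<tau> = 0\<close> show ?thesis by (simp add: A_def)
  next
    case False
    have u2: "t * u 2 \<tau> = - (t\<^sub>0 * slope (\<gamma> \<tau>) * u 1 \<tau>)" using rel by linarith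
    have u2': "t * u' 2 = - (t\<^sub>0 * ((u 1 \<tau> * P 1 slope (\<gamma> \<tau>) + u 2 \<tau> * P 2 slope (\<gamma> \<tau>)) * u 1 \<tau> +
      slope (\<gamma> \<tau>) * u' 1))" using rel' by linarith
    \<comment> \<open>Multiplying by the slope and \<open>t\<close> clears denominators, so it
      suffices to rewrite \<open>slope * G k\<close>, \<open>t * u 2\<close> and
      \<open>t * u' 2\<close>. The terms with \<open>P 2 slope\<close> cancel thanks to the minus
      sign in \<open>G 2\<close>.\<close>
    have "slope (\<gamma> \<tau>) * t * (A 1 * u 2 \<tau>) = slope (\<gamma> \<tau>) * t * (A 2 * u 1 \<tau>)"
    proof -
      have G: "slope (\<gamma> \<tau>) * G 1 (\<gamma> \<tau>) = P 1 slope (\<gamma> \<tau>)" "slope (\<gamma> \<tau>) * G 2 (\<gamma> \<tau>) = - P 2 slope (\<gamma> \<tau>)"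
        using slope_nonzero[OF p] by (simp_all add: G_def)
      have L: "slope (\<gamma> \<tau>) * t * (A 1 * u 2 \<tau>) =
          (slope (\<gamma> \<tau>) * u' 1 + slope (\<gamma> \<tau>) * G 1 (\<gamma> \<tau>) * (u 1 \<tau>)\<^sup>2) * (t * u 2 \<tau>)"
        by (simp add: A_def algebra_simps)
      have R: "slope (\<gamma> \<tau>) * t * (A 2 * u 1 \<tau>) =
          (slope (\<gamma> \<tau>) * (t * u' 2) + slope (\<gamma> \<tau>) * G 2 (\<gamma> \<tau>) * u 2 \<tau> * (t * u 2 \<tau>)) * u 1 \<tau>"
        by (simp add: A_def algebra_simps power2_eq_square)
      show ?thesis
        unfolding L R G u2 u2' by (simp add: algebra_simps power2_eq_square)
    qed
    then show ?thesis using False slope_nonzero[OF p] by simp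
  qed
  have "\<exists>c. A 1 = c * u 1 \<tau> \<and> A 2 = c * u 2 \<tau>"
  proof (cases "u 1 \<tau> = 0")
    case True
    have "v \<tau> \<noteq> 0" using nonzero by (simp add: v_def)
    with True have "u 2 \<tau> \<noteq> 0"
      using frame_expansion[OF p, of "v \<tau>"] by (auto simp: u_def)
    with True parallel show ?thesis by (intro exI[of _ "A 2 / u 2 \<tau>"]) simp
  next
    case False
    with parallel show ?thesis by (intro exI[of _ "A 1 / u 1 \<tau>"]) (simp add: field_simps)
  qed
  then obtain c where c: "A 1 = c * u 1 \<tau>" "A 2 = c * u 2 \<tau>" by blast
  have "acceleration nab \<gamma> \<tau> = c *\<^sub>R v \<tau>"
  proof (rule frame_eqI[OF p])
    fix k :: 2
    have "k = 1 \<or> k = 2" by (rule exhaust_2)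
    then show "Dv (\<lambda>r. \<phi> r $ k) (\<gamma> \<tau>) (acceleration nab \<gamma> \<tau>) = Dv (\<lambda>r. \<phi> r $ k) (\<gamma> \<tau>) (c *\<^sub>R v \<tau>)"
      using c by (auto simp: accel linear_Dv[OF diff[OF smooth_coord]] u_def)
  qed
  then show ?thesis by (auto simp: v_def)
qed

text \<open>Adapted coordinates enter only through the kernels of three differentials. Equal kernels
  force the coordinate change to act on each variable separately, and the claim becomes the
  transformation law of a Christoffel symbol in one variable, once for each
  \<open>k\<close>.\<close>

lemma local_connection_unique:
  assumes "web_coords U' \<phi>' w'"
    and ker: "\<And>q k v. q \<in> U \<inter> U' \<Longrightarrow> Dv (\<lambda>r. \<phi> r $ k) q v = 0 \<longleftrightarrow> Dv (\<lambda>r. \<phi>' r $ k) q v = 0"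
    and ker_w: "\<And>q v. q \<in> U \<inter> U' \<Longrightarrow> Dv w q v = 0 \<longleftrightarrow> Dv w' q v = 0"
    and q: "q \<in> U \<inter> U'" and Y: "smooth_on (U \<inter> U') Y"
  shows "local_connection U \<phi> w X Y q = local_connection U' \<phi>' w' X Y q"
proof -
  interpret c: web_coords U' \<phi>' w' by fact
  define S where "S = U \<inter> U'"
  have S: "open S" "q \<in> S" "S \<subseteq> U" "S \<subseteq> U'"
    using q open_U c.open_U by (auto simp: S_def)
  have U: "r \<in> U" "r \<in> U'" if "r \<in> S" for r using that S by auto
  note smooth' = smooth_on_subset[OF c.smooth_coord S(4)]
  \<comment> \<open>The diagonal of the Jacobian of the coordinate change; by \<open>off\<close> the
    other entries vanish.\<close>
  define \<alpha> where "\<alpha> = (\<lambda>k. P k (\<lambda>r. \<phi>' r $ k))"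
  have \<alpha>_smooth: "smooth_on S (\<alpha> k)" for k
    unfolding \<alpha>_def by (rule smooth_on_dirderiv[OF S(1) smooth_on_subset[OF smooth_E S(3)] smooth'])
  note \<alpha>_diff = smooth_onD_differentiable[OF \<alpha>_smooth]
  have off: "P j (\<lambda>r. \<phi>' r $ k) r = 0" if "r \<in> S" "j \<noteq> k" for r j k
    using ker[of r k "E j r"] that Dv_coord_E[OF U(1)[OF that(1)], of k j] by (simp add: S_def dirderiv_def)
  have \<alpha>_nz: "\<alpha> k r \<noteq> 0" if "r \<in> S" for r k
    using ker[of r k "E k r"] that Dv_coord_E[OF U(1)[OF that(1)], of k k] by (simp add: S_def dirderiv_def \<alpha>_def)
  \<comment> \<open>The k-th new coordinate depends on the k-th old one alone, and hence so does its
    derivative.\<close>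
  have \<alpha>_off: "P j (\<alpha> k) r = 0" if "r \<in> S" "j \<noteq> k" for r j k
  proof -
    have "P j (\<alpha> k) r = P k (P j (\<lambda>r. \<phi>' r $ k)) r"
      unfolding \<alpha>_def by (rule P_commute[OF S(1) smooth' that(1) U(1)[OF that(1)]])
    also have "\<dots> = P k (\<lambda>_. 0) r"
      by (rule dirderiv_cong_open[OF S(1) that(1)]) (rule off[OF _ that(2)])
    finally show ?thesis by (simp add: dirderiv_def)
  qed
  have cmp': "c.cmp Z k r = \<alpha> k r * cmp Z k r" if "r \<in> S" for Z k r
  proof -
    have "k = 1 \<or> k = 2" by (rule exhaust_2)
    then show ?thesis
      using dirderiv_frame[OF U(1)[OF that] smooth_onD_differentiable[OF smooth' that], of Z k] off[OF that]
      by (auto simp: \<alpha>_def)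
  qed
  have E': "E k r = \<alpha> k r *\<^sub>R c.E k r" if "r \<in> S" for k r
  proof (rule c.frame_eqI[OF U(2)[OF that]])
    fix j
    show "Dv (\<lambda>r. \<phi>' r $ j) r (E k r) = Dv (\<lambda>r. \<phi>' r $ j) r (\<alpha> k r *\<^sub>R c.E k r)"
      using off[OF that, of k j]
      by (auto simp: linear_Dv[OF smooth_onD_differentiable[OF smooth' that]] c.Dv_coord_E[OF U(2)[OF that]]
          \<alpha>_def dirderiv_def)
  qed
  have P': "P k f r = \<alpha> k r * c.P k f r" if "r \<in> S" "f differentiable (at r)" for k r f
    using E'[OF that(1)] by (simp add: dirderiv_def linear_Dv[OF that(2)])
  \<comment> \<open>The vector w_y E_1 - w_x E_2 lies in the kernel of dw, hence in that of dw'. So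
    both functions have the same slope in the old frame; passing to the new frame contributes the
    factor \<alpha>_1 / \<alpha>_2.\<close>
  have slope': "slope r = \<alpha> 1 r / \<alpha> 2 r * c.slope r" if "r \<in> S" for r
  proof -
    note dw = smooth_onD_differentiable[OF smooth_w U(1)[OF that]]
      smooth_onD_differentiable[OF c.smooth_w U(2)[OF that]]
    have "Dv w r (P 2 w r *\<^sub>R E 1 r - P 1 w r *\<^sub>R E 2 r) = 0"
      by (simp add: linear_Dv[OF dw(1)] dirderiv_def)
    then have "Dv w' r (P 2 w r *\<^sub>R E 1 r - P 1 w r *\<^sub>R E 2 r) = 0"
      using ker_w that by (simp add: S_def)
    then have "P 2 w r * P 1 w' r = P 1 w r * P 2 w' r"
      by (simp add: linear_Dv[OF dw(2)] dirderiv_def)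
    then have "slope r = P 1 w' r / P 2 w' r"
      using P_w_nonzero[OF U(1)[OF that]] c.P_w_nonzero[OF U(2)[OF that]] P'[OF that dw(2)] \<alpha>_nz[OF that]
      by (simp add: slope_def field_simps)
    then show ?thesis
      by (simp add: P'[OF that dw(2)] c.slope_def)
  qed
  note smooth_cs = smooth_on_subset[OF c.smooth_slope S(4)]
  note cs = smooth_onD_differentiable[OF smooth_cs]
  have G': "\<alpha> k q * G k q = P k (\<alpha> k) q + (\<alpha> k q)\<^sup>2 * c.G k q" for k
  proof -
    have sm: "smooth_on S (\<lambda>r. \<alpha> 1 r / \<alpha> 2 r)"
      by (intro smooth_on_divide S(1) \<alpha>_smooth \<alpha>_nz)
    have "P k slope q = P k (\<lambda>r. \<alpha> 1 r / \<alpha> 2 r * c.slope r) q"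
      by (rule dirderiv_cong_open[OF S(1,2) slope'])
    also have "\<dots> = P k (\<lambda>r. \<alpha> 1 r / \<alpha> 2 r) q * c.slope q + \<alpha> 1 q / \<alpha> 2 q * P k c.slope q"
      by (rule dirderiv_mult[OF smooth_onD_differentiable[OF sm S(2)] cs[OF S(2)]])
    also have "P k (\<lambda>r. \<alpha> 1 r / \<alpha> 2 r) q = (P k (\<alpha> 1) q * \<alpha> 2 q - \<alpha> 1 q * P k (\<alpha> 2) q) / (\<alpha> 2 q * \<alpha> 2 q)"
      by (rule dirderiv_divide[OF \<alpha>_diff[OF S(2)] \<alpha>_diff[OF S(2)] \<alpha>_nz[OF S(2)]])
    also have "P k c.slope q = \<alpha> k q * c.P k c.slope q"
      by (rule P'[OF S(2) cs[OF S(2)]])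
    finally have "P k slope q = (P k (\<alpha> 1) q * \<alpha> 2 q - \<alpha> 1 q * P k (\<alpha> 2) q) / (\<alpha> 2 q * \<alpha> 2 q) * c.slope q +
        \<alpha> 1 q / \<alpha> 2 q * (\<alpha> k q * c.P k c.slope q)" .
    note P_slope' = this
    have nz: "\<alpha> 1 q \<noteq> 0" "\<alpha> 2 q \<noteq> 0" "c.slope q \<noteq> 0"
      using \<alpha>_nz[OF S(2)] c.slope_nonzero[OF U(2)[OF S(2)]] by auto
    have off: "P 1 (\<alpha> 2) q = 0" "P 2 (\<alpha> 1) q = 0"
      by (simp_all add: \<alpha>_off S(2))
    have G: "G 1 q = P 1 slope q / slope q" "G 2 q = - P 2 slope q / slope q"
        "c.G 1 q = c.P 1 c.slope q / c.slope q" "c.G 2 q = - c.P 2 c.slope q / c.slope q"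
      by (simp_all add: G_def c.G_def)
    \<comment> \<open>Here \<open>a\<close> and \<open>b\<close> are the two factors \<alpha>,
      \<open>s\<close> is the new slope, \<open>da\<close> and \<open>db\<close> are the derivatives
      of the factors along their own variables, and \<open>ds\<close> is the derivative of the new
      slope. The zeros are the cross derivatives from \<open>off\<close>.\<close>
    have algebra: "a * (((da * b - a * 0) / (b * b) * s + a / b * (a * ds)) / (a / b * s)) = da + a\<^sup>2 * (ds / s)"
      "b * (- ((0 * b - a * db) / (b * b) * s + a / b * (b * ds)) / (a / b * s)) = db + b\<^sup>2 * (- ds / s)"
      if "a \<noteq> 0" "b \<noteq> 0" "s \<noteq> 0" for a b s da db ds :: real
      using that by (simp_all add: power2_eq_square) (simp_all add: field_simps)
    consider "k = 1" | "k = 2" using exhaust_2 by blast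
    then show ?thesis
    proof cases
      case 1
      show ?thesis
        unfolding 1 G P_slope'[unfolded 1] slope'[OF S(2)] off by (rule algebra(1)[OF nz])
    next
      case 2
      show ?thesis
        unfolding 2 G P_slope'[unfolded 2] slope'[OF S(2)] off by (rule algebra(2)[OF nz])
    qed
  qed
  \<comment> \<open>The inhomogeneous term of \<open>G'\<close> matches the derivative of \<alpha>
    in the product rule for the new component of \<open>Y\<close>. The remaining factor \<alpha> is
    later absorbed by the frame vector through \<open>E'\<close>.\<close>
  have coeff: "\<alpha> k q * (dirderiv X (cmp Y k) q + G k q * cmp X k q * cmp Y k q) =
      dirderiv X (c.cmp Y k) q + c.G k q * c.cmp X k q * c.cmp Y k q" for k
  proof -
    have "smooth_on S (cmp Y k)"
      using Y S_def by (intro smooth_on_dirderiv[OF S(1)] smooth_on_subset[OF smooth_coord S(3)]) simp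
    note d = smooth_onD_differentiable[OF this S(2)]
    have "dirderiv X (c.cmp Y k) q = dirderiv X (\<lambda>r. \<alpha> k r * cmp Y k r) q"
      by (rule dirderiv_cong_open[OF S(1,2) cmp'])
    also have "\<dots> = dirderiv X (\<alpha> k) q * cmp Y k q + \<alpha> k q * dirderiv X (cmp Y k) q"
      by (rule dirderiv_mult[OF \<alpha>_diff[OF S(2)] d])
    also have "dirderiv X (\<alpha> k) q = cmp X k q * P k (\<alpha> k) q"
    proof -
      have "k = 1 \<or> k = 2" by (rule exhaust_2)
      then show ?thesis
        using dirderiv_frame[OF U(1)[OF S(2)] \<alpha>_diff[OF S(2)], of X k] \<alpha>_off[OF S(2)] by auto
    qed
    finally have dX: "dirderiv X (c.cmp Y k) q =
      cmp X k q * P k (\<alpha> k) q * cmp Y k q + \<alpha> k q * dirderiv X (cmp Y k) q" .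
    have "\<alpha> k q * (dirderiv X (cmp Y k) q + G k q * cmp X k q * cmp Y k q) =
       \<alpha> k q * dirderiv X (cmp Y k) q + (\<alpha> k q * G k q) * cmp X k q * cmp Y k q"
      by (simp add: algebra_simps)
    then show ?thesis
      unfolding G' dX cmp'[OF S(2)] by (simp add: algebra_simps power2_eq_square)
  qed
  have "(dirderiv X (cmp Y k) q + G k q * cmp X k q * cmp Y k q) *\<^sub>R E k q =
      (dirderiv X (c.cmp Y k) q + c.G k q * c.cmp X k q * c.cmp Y k q) *\<^sub>R c.E k q" for k
    unfolding coeff[symmetric] E'[OF S(2)] by (simp add: mult.commute)
  then show ?thesis
    unfolding local_connection_eq[OF U(1)[OF S(2)]] c.local_connection_eq[OF U(2)[OF S(2)]] by simp
qed

end

section \<open>Adapted coordinates\<close>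

text \<open>Bootstrapping: the derivative of \<open>g\<close> is a smooth function composed with
  \<open>g\<close>, so \<open>g\<close> in C^k makes its derivative C^k and \<open>g\<close> itself
  C^(k+1).\<close>

lemma planar_smooth_inverse:
  fixes \<Phi> g :: "real^2 \<Rightarrow> real^2"
  assumes U: "open U" and smooth: "smooth_on U \<Phi>" and V: "open V" and g: "continuous_on V g" "g ` V \<subseteq> U"
    and deriv: "\<And>y. y \<in> V \<Longrightarrow> (g has_derivative inv (Dv \<Phi> (g y))) (at y)"
    and bij: "\<And>x. x \<in> U \<Longrightarrow> bij (Dv \<Phi> x)"
  shows "smooth_on V g"
proof -
  define e :: "2 \<Rightarrow> real^2" where "e k = axis k 1" for k
  define m where "m = (\<lambda>i j x. Dv \<Phi> x (e j) $ i)"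
  define dt where "dt = (\<lambda>x. m 1 1 x * m 2 2 x - m 1 2 x * m 2 1 x)"
  text \<open>Cramer's rule for the inverse of the Jacobian matrix \<open>m\<close>.\<close>
  define h where "h = (\<lambda>v::real^2. \<lambda>x. ((m 2 2 x * v $ 1 - m 1 2 x * v $ 2) / dt x) *\<^sub>R e 1 +
    ((m 1 1 x * v $ 2 - m 2 1 x * v $ 1) / dt x) *\<^sub>R e 2)"
  have Dv_e: "Dv \<Phi> x (a *\<^sub>R e 1 + b *\<^sub>R e 2) $ i = a * m i 1 x + b * m i 2 x" if "x \<in> U" for x a b i
    by (simp add: linear_Dv[OF smooth_onD_differentiable[OF smooth that]] m_def)
  have dt: "dt x \<noteq> 0" if "x \<in> U" for x
  proof
    assume 0: "dt x = 0"
    have ker: "a = 0 \<and> b = 0" if "a * m 1 1 x + b * m 1 2 x = 0" "a * m 2 1 x + b * m 2 2 x = 0" for a b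
    proof -
      have "Dv \<Phi> x (a *\<^sub>R e 1 + b *\<^sub>R e 2) = Dv \<Phi> x 0"
        using that by (simp add: vec_eq_iff forall_2 Dv_e[OF \<open>x \<in> U\<close>]
            linear_Dv(4)[OF smooth_onD_differentiable[OF smooth \<open>x \<in> U\<close>]])
      then have "a *\<^sub>R e 1 + b *\<^sub>R e 2 = 0"
        using bij_is_inj[OF bij[OF \<open>x \<in> U\<close>]] by (simp add: inj_eq)
      then show ?thesis by (simp add: vec_eq_iff forall_2 e_def axis_def)
    qed
    \<comment> \<open>With zero determinant the columns of the adjugate lie in the kernel;
      injectivity makes all entries vanish, and then (1,0) lies in the kernel as well.\<close>
    have "m 2 2 x = 0 \<and> - m 2 1 x = 0" "- m 1 2 x = 0 \<and> m 1 1 x = 0"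
      using 0 by (intro ker; simp add: dt_def algebra_simps)+
    then show False using ker[of 1 0] by simp
  qed
  have Dv_h: "Dv \<Phi> x (h v x) = v" if "x \<in> U" for x v
  proof -
    have "(m 2 2 x * v $ 1 - m 1 2 x * v $ 2) * m 1 1 x + (m 1 1 x * v $ 2 - m 2 1 x * v $ 1) * m 1 2 x = dt x * v $ 1"
      "(m 2 2 x * v $ 1 - m 1 2 x * v $ 2) * m 2 1 x + (m 1 1 x * v $ 2 - m 2 1 x * v $ 1) * m 2 2 x = dt x * v $ 2"
      by (simp_all add: dt_def algebra_simps)
    with dt[OF that] show ?thesis
      by (simp add: vec_eq_iff forall_2 h_def Dv_e[OF that] flip: add_divide_distrib)
  qed
  have smooth_h: "smooth_on U (h v)" for v
  proof -
    have m: "smooth_on U (m i j)" for i j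
      unfolding m_def by (intro smooth_on_nth[OF U] smooth_on_Dv smooth)
    then show ?thesis
      unfolding h_def dt_def diff_conv_add_uminus using dt
      by (intro smooth_on_add smooth_on_scaleR smooth_on_divide smooth_on_mult smooth_on_minus
          smooth_on_const U) (auto simp: dt_def)
  qed
  have Dv_g: "Dv g y v = h v (g y)" if "y \<in> V" for y v
  proof -
    have gy: "g y \<in> U" using that g(2) by auto
    have "inv (Dv \<Phi> (g y)) v = h v (g y)"
      by (rule inv_f_eq[OF bij_is_inj[OF bij[OF gy]] Dv_h[OF gy]])
    then show ?thesis using Dv_eqI[OF deriv[OF that]] by simp
  qed
  have "Ck_on k V g" for k
  proof (induction k)
    case 0
    then show ?case using g(1) by simp
  next
    case (Suc k)
    have "Ck_on k V (\<lambda>y. Dv g y v)" for v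
      by (rule Ck_on_cong[OF V _ Ck_on_compose[where f = "h v", OF V g(2) _ Suc.IH]])
        (use smooth_h[of v] in \<open>simp_all add: Dv_g smooth_on_def\<close>)
    then show ?case using deriv by (auto simp: differentiable_def)
  qed
  then show ?thesis by (simp add: smooth_on_def)
qed

text \<open>The inverse function theorem provides a local homeomorphism with differentiable inverse,
  and \<open>planar_smooth_inverse\<close> upgrades that inverse to a smooth one.\<close>

lemma smooth_chart_of_regular_point:
  fixes \<Phi> :: "real^2 \<Rightarrow> real^2"
  assumes W: "open W" "p \<in> W" "smooth_on W \<Phi>" and regular: "\<And>v. Dv \<Phi> p v = 0 \<Longrightarrow> v = 0"
  obtains U where "p \<in> U" "U \<subseteq> W" "smooth_chart U \<Phi>"
proof -
  define f' where "f' = (\<lambda>x. Blinfun (Dv \<Phi> x))"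
  have f': "blinfun_apply (f' x) = Dv \<Phi> x" if "x \<in> W" for x
    unfolding f'_def using has_derivative_Dv[OF smooth_onD_differentiable[OF W(3) that]]
    by (intro bounded_linear_Blinfun_apply has_derivative_bounded_linear)
  have deriv: "(\<Phi> has_derivative blinfun_apply (f' x)) (at x)" if "x \<in> W" for x
    using has_derivative_Dv[OF smooth_onD_differentiable[OF W(3) that]] f'[OF that] by simp
  have cont: "continuous_on W f'"
  proof (rule continuous_on_blinfun_componentwise)
    fix i :: "real^2"
    have "continuous_on W (\<lambda>x. Dv \<Phi> x i)"
      by (rule smooth_on_imp_continuous_on[OF smooth_on_Dv[OF W(3)]])
    then show "continuous_on W (\<lambda>x. blinfun_apply (f' x) i)"
      by (rule continuous_on_eq) (simp add: f')
  qed
  have lin: "linear (Dv \<Phi> p)"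
    by (rule linear_frechet_derivative[OF smooth_onD_differentiable[OF W(3,2)]])
  then have "inj (Dv \<Phi> p)"
    using regular by (simp add: linear_injective_0)
  \<comment> \<open>In finite dimension a trivial kernel gives a linear left inverse, the form of
    invertibility that \<open>inverse_function_theorem\<close> takes.\<close>
  then obtain k where k: "linear k" "k \<circ> Dv \<Phi> p = id"
    using linear_injective_left_inverse[OF lin] by blast
  have "Blinfun k o\<^sub>L f' p = id_blinfun"
    using k by (intro blinfun_eqI)
      (simp add: f'[OF W(2)] bounded_linear_Blinfun_apply linear_conv_bounded_linear fun_eq_iff)
  then obtain U V g g' where UV: "open U" "U \<subseteq> W" "p \<in> U" "open V" "\<Phi> p \<in> V" "homeomorphism U V \<Phi> g"
    and g: "\<And>y. y \<in> V \<Longrightarrow> (g has_derivative (g' y)) (at y)"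
    "\<And>y. y \<in> V \<Longrightarrow> g' y = inv (blinfun_apply (f' (g y)))"
    "\<And>y. y \<in> V \<Longrightarrow> bij (blinfun_apply (f' (g y)))"
    using inverse_function_theorem[OF W(1) deriv cont W(2)] by metis
  have hom: "\<Phi> ` U = V" "g ` V = U" "\<And>x. x \<in> U \<Longrightarrow> g (\<Phi> x) = x" "\<And>y. y \<in> V \<Longrightarrow> \<Phi> (g y) = y" "continuous_on V g"
    using UV(6) by (auto simp: homeomorphism_def)
  have inj: "inj_on \<Phi> U" by (rule inj_on_inverseI[of U g]) (rule hom(3))
  have gW: "g y \<in> W" if "y \<in> V" for y using that hom(2) UV(2) by auto
  have "smooth_on V g"
  proof (rule planar_smooth_inverse[OF UV(1) smooth_on_subset[OF W(3) UV(2)] UV(4) hom(5)])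
    show "bij (Dv \<Phi> x)" if "x \<in> U" for x
      using g(3)[of "\<Phi> x"] that hom f' UV(2) by auto
  qed (use g hom gW f' in auto)
  then have "smooth_on V (inv_into U \<Phi>)"
    by (rule smooth_on_cong[OF UV(4), rotated]) (use inj hom in \<open>auto intro!: inv_into_f_eq[symmetric]\<close>)
  then have "smooth_chart U \<Phi>"
    using UV inj hom smooth_on_subset[OF W(3) UV(2)] by (simp add: smooth_chart_def)
  with UV that show thesis by blast
qed

text \<open>In the chart the curve is a horizontal segment traversed with speed \<open>c\<close>. It
  stays in the leaf because the plaque through \<open>p\<close> is a full level set of the second
  coordinate.\<close>

lemma plaque_curve:
  assumes fol: "foliated_chart \<L> U \<phi>" and p: "p \<in> U" "p \<in> L" "L \<in> \<L>"
  obtains \<gamma> e where "e > 0" "smooth_on {-e<..<e} \<gamma>" "\<gamma> ` {-e<..<e} \<subseteq> L \<inter> U" "\<gamma> 0 = p"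
    "\<And>s. s \<in> {-e<..<e} \<Longrightarrow> (\<gamma> has_vector_derivative c *\<^sub>R coord_field U \<phi> 1 (\<gamma> s)) (at s)"
proof -
  interpret plane_chart U \<phi> by unfold_locales (use fol in \<open>simp add: foliated_chart_def\<close>)
  define l where "l = (\<lambda>s. \<phi> p + s *\<^sub>R (c *\<^sub>R axis 1 1))"
  define \<gamma> where "\<gamma> = (\<lambda>s. inv_into U \<phi> (l s))"
  obtain d where d: "d > 0" "ball (\<phi> p) d \<subseteq> \<phi> ` U"
    using open_image p(1) openE by (metis imageI)
  \<comment> \<open>The segment then stays in the ball of radius \<open>d\<close>; the summand 1
    covers \<open>c = 0\<close>.\<close>
  define e where "e = d / (\<bar>c\<bar> + 1)"
  have e: "e > 0" using d by (simp add: e_def)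
  have l: "l s \<in> \<phi> ` U" if "s \<in> {-e<..<e}" for s
  proof -
    have "dist (\<phi> p) (l s) = \<bar>s\<bar> * \<bar>c\<bar>" by (simp add: l_def dist_norm abs_mult)
    also have "\<dots> \<le> e * \<bar>c\<bar>" using that by (intro mult_right_mono) auto
    also have "\<dots> < e * (\<bar>c\<bar> + 1)" using e by simp
    also have "\<dots> = d" by (simp add: e_def)
    finally show ?thesis using d by auto
  qed
  have \<phi>_\<gamma>: "\<phi> (\<gamma> s) = l s" "\<gamma> s \<in> U" if "s \<in> {-e<..<e}" for s
    unfolding \<gamma>_def using l[OF that] by (simp_all add: f_inv_into_f inv_into_into)
  have l': "(l has_vector_derivative c *\<^sub>R axis 1 1) (at s)" for s
    unfolding l_def by (auto intro!: derivative_eq_intros)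
  have smooth_l: "smooth_on S l" if "open S" for S
    unfolding l_def
    by (intro smooth_on_add smooth_on_const smooth_on_bounded_linear bounded_linear_scaleR_left that)
  show thesis
  proof (rule that[OF e])
    show "smooth_on {-e<..<e} \<gamma>"
      unfolding \<gamma>_def using l by (intro smooth_on_compose[OF _ _ smooth_inv smooth_l]) auto
    show "\<gamma> 0 = p" using p inj by (simp add: \<gamma>_def l_def)
    show "(\<gamma> has_vector_derivative c *\<^sub>R E 1 (\<gamma> s)) (at s)" if "s \<in> {-e<..<e}" for s
    proof -
      note diff = smooth_onD_differentiable[OF smooth_inv l[OF that]]
      show ?thesis
        using has_derivative_compose[OF l'[of s, unfolded has_vector_derivative_def] has_derivative_Dv[OF diff]]
        by (simp add: has_vector_derivative_def \<gamma>_def[symmetric] linear_Dv[OF diff] coord_field_def \<phi>_\<gamma>[OF that])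
    qed
    \<comment> \<open>A foliated chart describes a component as some level set; containing
      \<open>p\<close> fixes the level.\<close>
    have "connected_component_set (U \<inter> L) p \<in> components (U \<inter> L)"
      using p by (simp add: componentsI)
    with fol p(3) obtain k where k: "connected_component_set (U \<inter> L) p = {q\<in>U. \<phi> q $ 2 = k}"
      unfolding foliated_chart_def by meson
    moreover have "p \<in> connected_component_set (U \<inter> L) p" using p by simp
    ultimately have "k = \<phi> p $ 2" by auto
    with k have "{q\<in>U. \<phi> q $ 2 = \<phi> p $ 2} \<subseteq> L"
      using connected_component_subset[of "U \<inter> L" p] by auto
    then show "\<gamma> ` {-e<..<e} \<subseteq> L \<inter> U"
      using \<phi>_\<gamma> by (auto simp: l_def axis_def)
  qed
qed

text \<open>Plaque curves show that \<open>E 1 q\<close> is tangent. As the tangent set is the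
  kernel of a nonzero form, it is a line and thus spanned by \<open>E 1 q\<close>, so no other curve
  in the leaf has to be examined.\<close>

lemma tangent_of_foliated_chart:
  fixes \<omega> :: "(real^2) \<Rightarrow>\<^sub>L real"
  assumes part: "partition_on UNIV \<L>" and fol: "foliated_chart \<L> U \<phi>" and q: "q \<in> U"
    and \<omega>: "tangent \<L> q = {v. blinfun_apply \<omega> v = 0}" "\<omega> \<noteq> 0"
  shows "tangent \<L> q = {v. Dv (\<lambda>r. \<phi> r $ 2) q v = 0}"
proof -
  interpret plane_chart U \<phi> by unfold_locales (use fol in \<open>simp add: foliated_chart_def\<close>)
  obtain L where L: "q \<in> L" "L \<in> \<L>" using part by (auto simp: partition_on_def)
  note expand = frame_expansion[OF q]
  have ker: "blinfun_apply \<omega> (c *\<^sub>R E 1 q) = 0" for c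
  proof -
    obtain \<gamma> e where \<gamma>: "e > 0" "smooth_on {-e<..<e} \<gamma>" "\<gamma> ` {-e<..<e} \<subseteq> L \<inter> U" "\<gamma> 0 = q"
      "\<And>s. s \<in> {-e<..<e} \<Longrightarrow> (\<gamma> has_vector_derivative c *\<^sub>R coord_field U \<phi> 1 (\<gamma> s)) (at s)"
      using plaque_curve[OF fol q L] by metis
    then have "vector_derivative \<gamma> (at 0) = c *\<^sub>R E 1 q"
      using \<gamma>(5)[of 0] by (simp add: vector_derivative_at)
    then have "c *\<^sub>R E 1 q \<in> tangent \<L> q"
      unfolding tangent_def using \<gamma> L by blast
    then show ?thesis using \<omega> by simp
  qed
  have eq: "blinfun_apply \<omega> v = Dv (\<lambda>r. \<phi> r $ 2) q v * blinfun_apply \<omega> (E 2 q)" for v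
    by (subst expand[of v]) (simp add: blinfun.add_right blinfun.scaleR_right ker[of 1, simplified])
  have "blinfun_apply \<omega> (E 2 q) \<noteq> 0"
    using \<omega>(2) eq by (metis blinfun_eqI mult_zero_right zero_blinfun.rep_eq)
  then have "blinfun_apply \<omega> v = 0 \<longleftrightarrow> Dv (\<lambda>r. \<phi> r $ 2) q v = 0" for v
    unfolding eq[of v] by simp
  then show ?thesis unfolding \<omega>(1) by simp
qed

section \<open>Linear algebra of the web at a point and existence of adapted coordinates\<close>

lemma veronese_web_forms:
  assumes "veronese_web F"
  obtains \<omega>\<^sub>0 \<omega>\<^sub>1 :: "(real^2) \<Rightarrow>\<^sub>L real" where
    "\<And>a b. a *\<^sub>R \<omega>\<^sub>0 + b *\<^sub>R \<omega>\<^sub>1 = 0 \<Longrightarrow> a = 0 \<and> b = 0"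
    "\<And>s t. (s, t) \<noteq> (0, 0) \<Longrightarrow> tangent (F s t) q = {v. s * blinfun_apply \<omega>\<^sub>0 v + t * blinfun_apply \<omega>\<^sub>1 v = 0}"
proof -
  from assms[unfolded veronese_web_def, THEN conjunct2, THEN conjunct2, THEN spec, of q]
  obtain U and \<omega>\<^sub>0 \<omega>\<^sub>1 :: "real^2 \<Rightarrow> ((real^2) \<Rightarrow>\<^sub>L real)" where q: "q \<in> U" and
    *: "\<forall>q\<in>U. (\<forall>a b. a *\<^sub>R \<omega>\<^sub>0 q + b *\<^sub>R \<omega>\<^sub>1 q = 0 \<longrightarrow> a = 0 \<and> b = 0) \<and>
           (\<forall>s t. (s, t) \<noteq> (0, 0) \<longrightarrow>
              tangent (F s t) q = {v. blinfun_apply (s *\<^sub>R \<omega>\<^sub>0 q + t *\<^sub>R \<omega>\<^sub>1 q) v = 0})"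
    by (elim exE conjE) (rule that)
  show thesis
  proof
    show "a = 0 \<and> b = 0" if "a *\<^sub>R \<omega>\<^sub>0 q + b *\<^sub>R \<omega>\<^sub>1 q = 0" for a b
      using * q that by blast
    show "tangent (F s t) q = {v. s * blinfun_apply (\<omega>\<^sub>0 q) v + t * blinfun_apply (\<omega>\<^sub>1 q) v = 0}"
      if "(s, t) \<noteq> (0, 0)" for s t
      using * q that by (simp add: blinfun.add_left blinfun.scaleR_left)
  qed
qed

lemma local_defining_function:
  assumes web: "veronese_web F" and st: "(s, t) \<noteq> (0, 0)"
  obtains U and x :: "real^2 \<Rightarrow> real" where "open U" "p \<in> U" "smooth_on U x"
    "\<And>q. q \<in> U \<Longrightarrow> tangent (F s t) q = {v. Dv x q v = 0}"
proof -
  have "foliation (F s t)"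
    using web[unfolded veronese_web_def, THEN conjunct1] st by blast
  then obtain U \<phi> where U: "partition_on UNIV (F s t)" "p \<in> U" "foliated_chart (F s t) U \<phi>"
    unfolding foliation_def by meson
  interpret plane_chart U \<phi> by unfold_locales (use U in \<open>simp add: foliated_chart_def\<close>)
  show thesis
  proof (rule that[OF open_U U(2) smooth_coord])
    fix q assume q: "q \<in> U"
    obtain \<omega>\<^sub>0 \<omega>\<^sub>1 :: "(real^2) \<Rightarrow>\<^sub>L real" where \<omega>:
      "\<And>a b. a *\<^sub>R \<omega>\<^sub>0 + b *\<^sub>R \<omega>\<^sub>1 = 0 \<Longrightarrow> a = 0 \<and> b = 0"
      "\<And>s t. (s, t) \<noteq> (0, 0) \<Longrightarrow> tangent (F s t) q = {v. s * blinfun_apply \<omega>\<^sub>0 v + t * blinfun_apply \<omega>\<^sub>1 v = 0}"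
      by (rule veronese_web_forms[OF web]) (rule that)
    show "tangent (F s t) q = {v. Dv (\<lambda>r. \<phi> r $ 2) q v = 0}"
    \<comment> \<open>Independence of the two forms makes the one belonging to \<open>(s:t)\<close>
      nonzero, as required.\<close>
    proof (rule tangent_of_foliated_chart[OF U(1,3) q])
      show "tangent (F s t) q = {v. blinfun_apply (s *\<^sub>R \<omega>\<^sub>0 + t *\<^sub>R \<omega>\<^sub>1) v = 0}"
        unfolding \<omega>(2)[OF st] by (simp add: blinfun.add_left blinfun.scaleR_left)
      show "s *\<^sub>R \<omega>\<^sub>0 + t *\<^sub>R \<omega>\<^sub>1 \<noteq> 0" using \<omega>(1)[of s t] st by blast
    qed
  qed
qed

text \<open>Two forms on the plane vanishing on the same nonzero vector are determined by their
  values on one complementary vector, hence are proportional.\<close>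

lemma independent_forms_common_kernel:
  fixes \<omega>\<^sub>0 \<omega>\<^sub>1 :: "(real^2) \<Rightarrow>\<^sub>L real"
  assumes indep: "\<And>a b. a *\<^sub>R \<omega>\<^sub>0 + b *\<^sub>R \<omega>\<^sub>1 = 0 \<Longrightarrow> a = 0 \<and> b = 0"
    and v: "blinfun_apply \<omega>\<^sub>0 v = 0" "blinfun_apply \<omega>\<^sub>1 v = 0"
  shows "v = 0"
proof (rule ccontr)
  assume "v \<noteq> 0"
  \<comment> \<open>\<open>v\<close> rotated by a right angle; \<open>v\<close> and \<open>e\<close>
    form an orthogonal basis, and \<open>n\<close> is the squared length of each.\<close>
  define e :: "real^2" where "e = vector [- v $ 2, v $ 1]"
  define n where "n = (v $ 1)\<^sup>2 + (v $ 2)\<^sup>2"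
  have n: "n \<noteq> 0" using \<open>v \<noteq> 0\<close> by (simp add: n_def vec_eq_iff forall_2 sum_power2_eq_zero_iff)
  have zero: "\<omega> = 0" if "blinfun_apply \<omega> v = 0" "blinfun_apply \<omega> e = 0" for \<omega> :: "(real^2) \<Rightarrow>\<^sub>L real"
  proof (rule blinfun_eqI)
    fix u
    have "n *\<^sub>R u = (u $ 1 * v $ 1 + u $ 2 * v $ 2) *\<^sub>R v + (u $ 2 * v $ 1 - u $ 1 * v $ 2) *\<^sub>R e"
      by (simp add: vec_eq_iff forall_2 e_def n_def power2_eq_square algebra_simps)
    from arg_cong[OF this, of "blinfun_apply \<omega>"] have "n * blinfun_apply \<omega> u = 0"
      using that by (simp add: blinfun.add_right blinfun.scaleR_right)
    then show "blinfun_apply \<omega> u = blinfun_apply 0 u" using n by simp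
  qed
  \<comment> \<open>This combination vanishes on \<open>v\<close> and is chosen to vanish on
    \<open>e\<close>; independence then kills both coefficients.\<close>
  have "blinfun_apply \<omega>\<^sub>1 e *\<^sub>R \<omega>\<^sub>0 + (- blinfun_apply \<omega>\<^sub>0 e) *\<^sub>R \<omega>\<^sub>1 = 0"
    by (rule zero) (simp_all add: blinfun.add_left blinfun.diff_left blinfun.scaleR_left v)
  then have "\<omega>\<^sub>0 = 0"
    using indep[of "blinfun_apply \<omega>\<^sub>1 e" "- blinfun_apply \<omega>\<^sub>0 e"] zero[of \<omega>\<^sub>0] v(1) by simp
  then show False using indep[of 1 0] by simp
qed

lemma exists_adapted:
  assumes web: "veronese_web F" and t\<^sub>0: "t\<^sub>0 \<noteq> 0"
  obtains U \<phi> w where "p \<in> U" "adapted F t\<^sub>0 U \<phi> w"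
proof -
  obtain Ux and x :: "real^2 \<Rightarrow> real" where x: "open Ux" "p \<in> Ux" "smooth_on Ux x"
    "\<And>q. q \<in> Ux \<Longrightarrow> tangent (F 1 0) q = {v. Dv x q v = 0}"
    by (rule local_defining_function[OF web, of 1 0 p]) (simp, rule that)
  obtain Uy and y :: "real^2 \<Rightarrow> real" where y: "open Uy" "p \<in> Uy" "smooth_on Uy y"
    "\<And>q. q \<in> Uy \<Longrightarrow> tangent (F 0 1) q = {v. Dv y q v = 0}"
    by (rule local_defining_function[OF web, of 0 1 p]) (simp, rule that)
  obtain Uw and w :: "real^2 \<Rightarrow> real" where w: "open Uw" "p \<in> Uw" "smooth_on Uw w"
    "\<And>q. q \<in> Uw \<Longrightarrow> tangent (F 1 t\<^sub>0) q = {v. Dv w q v = 0}"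
    by (rule local_defining_function[OF web, of 1 t\<^sub>0 p]) (simp, rule that)
  define W where "W = Ux \<inter> Uy \<inter> Uw"
  have W: "open W" "p \<in> W" "W \<subseteq> Ux" "W \<subseteq> Uy" "W \<subseteq> Uw" using x y w by (auto simp: W_def)
  define \<Phi> :: "real^2 \<Rightarrow> real^2" where "\<Phi> = (\<lambda>q. x q *\<^sub>R axis 1 1 + y q *\<^sub>R axis 2 1)"
  have coord: "(\<lambda>r. \<Phi> r $ 1) = x" "(\<lambda>r. \<Phi> r $ 2) = y"
    by (simp_all add: \<Phi>_def axis_def fun_eq_iff)
  have smooth: "smooth_on W \<Phi>"
    unfolding \<Phi>_def using W x y
    by (intro smooth_on_add smooth_on_scaleR smooth_on_const) (auto intro: smooth_on_subset)
  \<comment> \<open>A vector in the kernel is tangent to both F_0 and F_oo, hence killed by two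
    independent forms.\<close>
  have regular: "v = 0" if "Dv \<Phi> p v = 0" for v
  proof -
    obtain \<omega>\<^sub>0 \<omega>\<^sub>1 :: "(real^2) \<Rightarrow>\<^sub>L real" where \<omega>:
      "\<And>a b. a *\<^sub>R \<omega>\<^sub>0 + b *\<^sub>R \<omega>\<^sub>1 = 0 \<Longrightarrow> a = 0 \<and> b = 0"
      "\<And>s t. (s, t) \<noteq> (0, 0) \<Longrightarrow> tangent (F s t) p = {v. s * blinfun_apply \<omega>\<^sub>0 v + t * blinfun_apply \<omega>\<^sub>1 v = 0}"
      by (rule veronese_web_forms[OF web]) (rule that)
    have "Dv (\<lambda>r. \<Phi> r $ k) p v = 0" for k
      using Dv_eqI[OF bounded_linear.has_derivative[OF bounded_linear_vec_nth[of k]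
            has_derivative_Dv[OF smooth_onD_differentiable[OF smooth W(2)]]]] that
      by simp
    from this[of 1] this[of 2] have "Dv x p v = 0" "Dv y p v = 0"
      by (simp_all add: coord)
    then have "v \<in> tangent (F 1 0) p" "v \<in> tangent (F 0 1) p"
      using x y by auto
    then have "blinfun_apply \<omega>\<^sub>0 v = 0" "blinfun_apply \<omega>\<^sub>1 v = 0"
      using \<omega>(2)[of 1 0] \<omega>(2)[of 0 1] by auto
    then show "v = 0" using independent_forms_common_kernel[of \<omega>\<^sub>0 \<omega>\<^sub>1 v] \<omega>(1) by blast
  qed
  obtain U where U: "p \<in> U" "U \<subseteq> W" "smooth_chart U \<Phi>"
    by (rule smooth_chart_of_regular_point[OF W(1,2) smooth]) (erule regular, rule that)
  interpret plane_chart U \<Phi> by unfold_locales (rule U)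
  have tangents: "tangent (F 1 0) q = {v. Dv x q v = 0}" "tangent (F 0 1) q = {v. Dv y q v = 0}"
    "tangent (F 1 t\<^sub>0) q = {v. Dv w q v = 0}" if "q \<in> U" for q
    using x(4)[of q] y(4)[of q] w(4)[of q] that U(2) by (auto simp: W_def)
  \<comment> \<open>\<open>E 1 q\<close> is killed by \<open>\<omega>\<^sub>1\<close> but not by
    \<open>\<omega>\<^sub>0\<close>, and \<open>E 2 q\<close> the other way round. So the form of
    \<open>t\<^sub>0\<close>, whose kernel is that of dw, is nonzero on both; the second case uses
    \<open>t\<^sub>0 \<noteq> 0\<close>.\<close>
  have nonzero: "P 1 w q \<noteq> 0 \<and> P 2 w q \<noteq> 0" if q: "q \<in> U" for q
  proof -
    obtain \<omega>\<^sub>0 \<omega>\<^sub>1 :: "(real^2) \<Rightarrow>\<^sub>L real" where \<omega>: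
      "\<And>s t. (s, t) \<noteq> (0, 0) \<Longrightarrow> tangent (F s t) q = {v. s * blinfun_apply \<omega>\<^sub>0 v + t * blinfun_apply \<omega>\<^sub>1 v = 0}"
      by (rule veronese_web_forms[OF web]) (rule that)
    have ker: "Dv x q v = 0 \<longleftrightarrow> blinfun_apply \<omega>\<^sub>0 v = 0" "Dv y q v = 0 \<longleftrightarrow> blinfun_apply \<omega>\<^sub>1 v = 0"
      "Dv w q v = 0 \<longleftrightarrow> blinfun_apply \<omega>\<^sub>0 v + t\<^sub>0 * blinfun_apply \<omega>\<^sub>1 v = 0" for v
      using \<omega>[of 1 0] \<omega>[of 0 1] \<omega>[of 1 t\<^sub>0] tangents[OF q] by (auto simp: set_eq_iff)
    have dE: "Dv x q (E 1 q) = 1" "Dv x q (E 2 q) = 0" "Dv y q (E 1 q) = 0" "Dv y q (E 2 q) = 1"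
      using Dv_coord_E[OF q, of 1] Dv_coord_E[OF q, of 2] by (simp_all add: coord)
    have "Dv w q (E 1 q) \<noteq> 0"
      using ker(1)[of "E 1 q"] ker(2)[of "E 1 q"] ker(3)[of "E 1 q"] dE by auto
    moreover have "Dv w q (E 2 q) \<noteq> 0"
      using ker(1)[of "E 2 q"] ker(2)[of "E 2 q"] ker(3)[of "E 2 q"] dE t\<^sub>0 by auto
    ultimately show ?thesis by (simp add: dirderiv_def)
  qed
  have "smooth_on U w" by (rule smooth_on_subset[OF w(3)]) (use U(2) W in auto)
  then have "adapted F t\<^sub>0 U \<Phi> w"
    unfolding adapted_def coord by (simp add: U(3) tangents nonzero)
  with U(1) show thesis by (rule that)
qed

section \<open>The web connection\<close>

lemma adapted_web_coords:
  assumes "adapted F t\<^sub>0 U \<phi> w"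
  shows "web_coords U \<phi> w"
proof
  show "smooth_chart U \<phi>" "smooth_on U w"
    using assms by (simp_all add: adapted_def)
  show "dirderiv (coord_field U \<phi> 1) w q \<noteq> 0" "dirderiv (coord_field U \<phi> 2) w q \<noteq> 0" if "q \<in> U" for q
    using assms that by (simp_all add: adapted_def)
qed

lemma adapted_tangent:
  assumes "adapted F t\<^sub>0 U \<phi> w" "q \<in> U"
  shows "tangent (F 1 0) q = {v. Dv (\<lambda>r. \<phi> r $ 1) q v = 0}"
    "tangent (F 0 1) q = {v. Dv (\<lambda>r. \<phi> r $ 2) q v = 0}"
    "tangent (F 1 t\<^sub>0) q = {v. Dv w q v = 0}"
  using assms by (simp_all add: adapted_def)

text \<open>Replaces the pointwise choices by the one made at \<open>p\<close>. At \<open>p\<close>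
  this is the definition and holds for all fields; at other points of \<open>U\<close> it rests on
  \<open>local_connection_unique\<close>, which requires a smooth second argument.\<close>

lemma web_connection_local:
  assumes "veronese_web F" "t\<^sub>0 \<noteq> 0"
  obtains U \<phi> w where "p \<in> U" "adapted F t\<^sub>0 U \<phi> w"
    "\<And>X Y. web_connection F t\<^sub>0 X Y p = local_connection U \<phi> w X Y p"
    "\<And>X Y q. q \<in> U \<Longrightarrow> smooth_on UNIV Y \<Longrightarrow> web_connection F t\<^sub>0 X Y q = local_connection U \<phi> w X Y q"
proof -
  have ex: "\<exists>U \<phi> w. q \<in> U \<and> adapted F t\<^sub>0 U \<phi> w \<and>
    (\<forall>X Y. web_connection F t\<^sub>0 X Y q = local_connection U \<phi> w X Y q)" for q
  proof -
    let ?P = "\<lambda>(U, \<phi>, w). q \<in> U \<and> adapted F t\<^sub>0 U \<phi> w"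
    obtain U \<phi> w where "(SOME c. ?P c) = (U, \<phi>, w)" by (cases "SOME c. ?P c")
    moreover have "?P (SOME c. ?P c)"
      by (rule someI_ex) (rule exists_adapted[OF assms, of q], auto)
    ultimately show ?thesis unfolding web_connection_def by auto
  qed
  obtain U \<phi> w where p: "p \<in> U" "adapted F t\<^sub>0 U \<phi> w"
    "\<And>X Y. web_connection F t\<^sub>0 X Y p = local_connection U \<phi> w X Y p" using ex by metis
  show thesis
  proof (rule that[OF p])
    fix X Y :: vfield and q assume q: "q \<in> U" and Y: "smooth_on UNIV Y"
    \<comment> \<open>The coordinates selected at \<open>q\<close> may differ from those at
      \<open>p\<close>, but both systems describe the same three tangent lines on the
      overlap.\<close>
    obtain U' \<phi>' w' where c: "q \<in> U'" "adapted F t\<^sub>0 U' \<phi>' w'"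
      "web_connection F t\<^sub>0 X Y q = local_connection U' \<phi>' w' X Y q" using ex by metis
    have "local_connection U \<phi> w X Y q = local_connection U' \<phi>' w' X Y q"
    proof (rule web_coords.local_connection_unique[OF adapted_web_coords[OF p(2)] adapted_web_coords[OF c(2)]])
      show "q \<in> U \<inter> U'" using q c by simp
      show "smooth_on (U \<inter> U') Y" by (rule smooth_on_subset[OF Y]) simp
      fix r v assume r: "r \<in> U \<inter> U'"
      note tangent = adapted_tangent[OF p(2), of r] adapted_tangent[OF c(2), of r]
      show "Dv w r v = 0 \<longleftrightarrow> Dv w' r v = 0"
        using tangent(3,6) r by (simp add: set_eq_iff)
      fix k :: 2
      have "k = 1 \<or> k = 2" by (rule exhaust_2)
      then show "Dv (\<lambda>r. \<phi> r $ k) r v = 0 \<longleftrightarrow> Dv (\<lambda>r. \<phi>' r $ k) r v = 0"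
        using tangent(1,2,4,5) r by (auto simp: set_eq_iff)
    qed
    with c show "web_connection F t\<^sub>0 X Y q = local_connection U \<phi> w X Y q" by simp
  qed
qed

text \<open>The forms of the web are multiples of dx and dy, and the leaf direction of
  \<open>t\<^sub>0\<close> fixes their ratio. This yields the normal form ker(t_0 w_x dx + t w_y
  dy), here divided by w_y.\<close>

lemma tangent_slope:
  assumes web: "veronese_web F" and ad: "adapted F t\<^sub>0 U \<phi> w" and q: "q \<in> U"
    and v: "v \<in> tangent (F 1 t) q"
  shows "t\<^sub>0 * web_coords.slope U \<phi> w q * Dv (\<lambda>r. \<phi> r $ 1) q v + t * Dv (\<lambda>r. \<phi> r $ 2) q v = 0"
proof -
  interpret web_coords U \<phi> w by (rule adapted_web_coords[OF ad])
  obtain \<omega>\<^sub>0 \<omega>\<^sub>1 :: "(real^2) \<Rightarrow>\<^sub>L real" where \<omega>: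
      "\<And>a b. a *\<^sub>R \<omega>\<^sub>0 + b *\<^sub>R \<omega>\<^sub>1 = 0 \<Longrightarrow> a = 0 \<and> b = 0"
    "\<And>s t. (s, t) \<noteq> (0, 0) \<Longrightarrow> tangent (F s t) q = {v. s * blinfun_apply \<omega>\<^sub>0 v + t * blinfun_apply \<omega>\<^sub>1 v = 0}"
    by (rule veronese_web_forms[OF web]) (rule that)
  have tangents: "tangent (F 1 0) q = {v. Dv (\<lambda>r. \<phi> r $ 1) q v = 0}"
    "tangent (F 0 1) q = {v. Dv (\<lambda>r. \<phi> r $ 2) q v = 0}" "tangent (F 1 t\<^sub>0) q = {v. Dv w q v = 0}"
    by (rule adapted_tangent[OF ad q])+
  have ker: "Dv (\<lambda>r. \<phi> r $ 1) q v = 0 \<longleftrightarrow> blinfun_apply \<omega>\<^sub>0 v = 0" "Dv (\<lambda>r. \<phi> r $ 2) q v = 0 \<longleftrightarrow> blinfun_apply \<omega>\<^sub>1 v = 0"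
      "Dv w q v = 0 \<longleftrightarrow> blinfun_apply \<omega>\<^sub>0 v + t\<^sub>0 * blinfun_apply \<omega>\<^sub>1 v = 0" for v
    using \<omega>(2)[of 1 0] \<omega>(2)[of 0 1] \<omega>(2)[of 1 t\<^sub>0] tangents by (auto simp: set_eq_iff)
  define a b where "a = blinfun_apply \<omega>\<^sub>0 (E 1 q)" and "b = blinfun_apply \<omega>\<^sub>1 (E 2 q)"
  have off: "blinfun_apply \<omega>\<^sub>0 (E 2 q) = 0" "blinfun_apply \<omega>\<^sub>1 (E 1 q) = 0"
    using ker(1)[of "E 2 q"] ker(2)[of "E 1 q"] Dv_coord_E[OF q] by auto
  have \<omega>_eq: "blinfun_apply \<omega>\<^sub>0 u = Dv (\<lambda>r. \<phi> r $ 1) q u * a" "blinfun_apply \<omega>\<^sub>1 u = Dv (\<lambda>r. \<phi> r $ 2) q u * b" for u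
    by (subst frame_expansion[OF q, of u], simp add: blinfun.add_right blinfun.scaleR_right off a_def b_def)+
  have "\<omega>\<^sub>1 \<noteq> 0" using \<omega>(1)[of 0 1] by auto
  then have "b \<noteq> 0"
    using \<omega>_eq(2) by (metis blinfun_eqI mult_zero_right zero_blinfun.rep_eq)
  \<comment> \<open>A vector spanning the kernel of dw; evaluating the form of
    \<open>t\<^sub>0\<close> on it relates \<open>a\<close> and \<open>b\<close>.\<close>
  have "Dv w q (P 2 w q *\<^sub>R E 1 q - P 1 w q *\<^sub>R E 2 q) = 0"
    by (simp add: linear_Dv[OF smooth_onD_differentiable[OF smooth_w q]] dirderiv_def)
  then have "P 2 w q * a = t\<^sub>0 * P 1 w q * b"
    unfolding ker(3) by (simp add: blinfun.diff_right blinfun.scaleR_right off a_def b_def)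
  then have a: "a = t\<^sub>0 * slope q * b"
    using P_w_nonzero[OF q] by (simp add: slope_def field_simps)
  have "blinfun_apply \<omega>\<^sub>0 v + t * blinfun_apply \<omega>\<^sub>1 v = 0"
    using v \<omega>(2)[of 1 t] by simp
  then have "b * (t\<^sub>0 * slope q * Dv (\<lambda>r. \<phi> r $ 1) q v + t * Dv (\<lambda>r. \<phi> r $ 2) q v) = 0"
    unfolding \<omega>_eq a by (simp add: algebra_simps)
  with \<open>b \<noteq> 0\<close> show ?thesis by simp
qed

text \<open>\<open>tangent\<close> tests curves at parameter 0 on a symmetric interval, so the
  parameter is translated by \<open>\<sigma>\<close> and \<open>e\<close> is the distance to the
  nearer end.\<close>

lemma velocity_in_tangent:
  assumes L: "L \<in> \<L>" and \<gamma>: "smooth_on {a<..<b} \<gamma>" "\<gamma> ` {a<..<b} \<subseteq> L" and \<sigma>: "\<sigma> \<in> {a<..<b}"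
  shows "vector_derivative \<gamma> (at \<sigma>) \<in> tangent \<L> (\<gamma> \<sigma>)"
proof -
  define e where "e = min (\<sigma> - a) (b - \<sigma>)"
  have e: "e > 0" and shift: "\<And>s. s \<in> {-e<..<e} \<Longrightarrow> \<sigma> + s \<in> {a<..<b}" using \<sigma> by (auto simp: e_def)
  have "smooth_on {-e<..<e} (\<lambda>s. \<gamma> (\<sigma> + s))"
    by (rule smooth_on_compose[OF open_greaterThanLessThan _ \<gamma>(1) smooth_on_add[OF
          open_greaterThanLessThan smooth_on_const smooth_on_bounded_linear[OF bounded_linear_ident]]])
      (use shift in blast)
  moreover have "((\<lambda>s. \<gamma> (\<sigma> + s)) has_vector_derivative vector_derivative \<gamma> (at \<sigma>)) (at 0)"
  proof -
    have "(\<gamma> has_vector_derivative vector_derivative \<gamma> (at \<sigma>)) (at \<sigma>)"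
      using smooth_onD_differentiable[OF \<gamma>(1) \<sigma>] by (simp add: vector_derivative_works differentiableI_vector
          frechet_derivative_works has_vector_derivative_def frechet_derivative_eq_vector_derivative)
    then have g: "(\<gamma> has_derivative (\<lambda>h. h *\<^sub>R vector_derivative \<gamma> (at \<sigma>))) (at (\<sigma> + 0))"
      by (simp add: has_vector_derivative_def)
    have "((\<lambda>s. \<sigma> + s) has_derivative (\<lambda>h. h)) (at 0)"
      by (auto intro!: derivative_eq_intros)
    from has_derivative_compose[OF this g] show ?thesis by (simp add: has_vector_derivative_def)
  qed
  then have "vector_derivative (\<lambda>s. \<gamma> (\<sigma> + s)) (at 0) = vector_derivative \<gamma> (at \<sigma>)"
    by (rule vector_derivative_at)
  moreover have "(\<lambda>s. \<gamma> (\<sigma> + s)) ` {-e<..<e} \<subseteq> L" using \<gamma>(2) shift by blast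
  ultimately show ?thesis
    unfolding tangent_def using L e by (intro CollectI bexI[of _ L] exI[of _ "\<lambda>s. \<gamma> (\<sigma> + s)"] exI[of _ e]) auto
qed

text \<open>Two unrelated charts are used: a foliated chart of this leaf's own foliation for a
  regular parametrisation, and adapted coordinates of the web for the acceleration.\<close>

lemma leaf_geodesic:
  assumes web: "veronese_web F" and t\<^sub>0: "t\<^sub>0 \<noteq> 0" and L: "L \<in> F 1 t"
  shows "unparametrised_geodesic (web_connection F t\<^sub>0) L"
  unfolding unparametrised_geodesic_def
proof (intro conjI ballI allI impI)
  fix p assume p: "p \<in> L"
  have "foliation (F 1 t)" using web unfolding veronese_web_def by simp
  then obtain U \<phi> where U: "partition_on UNIV (F 1 t)" "p \<in> U" "foliated_chart (F 1 t) U \<phi>"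
    unfolding foliation_def by meson
  interpret plane_chart U \<phi> by unfold_locales (use U in \<open>simp add: foliated_chart_def\<close>)
  obtain \<gamma> e where \<gamma>: "e > 0" "smooth_on {-e<..<e} \<gamma>" "\<gamma> ` {-e<..<e} \<subseteq> L \<inter> U" "\<gamma> 0 = p"
      "\<And>s. s \<in> {-e<..<e} \<Longrightarrow> (\<gamma> has_vector_derivative 1 *\<^sub>R coord_field U \<phi> 1 (\<gamma> s)) (at s)"
    using plaque_curve[OF U(3,2) p L] by metis
  have "vector_derivative \<gamma> (at s) \<noteq> 0" if s: "s \<in> {-e<..<e}" for s
  proof -
    have "\<gamma> s \<in> U" using \<gamma>(3) s by auto
    then have "E 1 (\<gamma> s) \<noteq> 0"
      using Dv_coord_E[of "\<gamma> s" 1 1] linear_Dv(4)[OF smooth_onD_differentiable[OF smooth_coord]] by fastforce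
    then show ?thesis using vector_derivative_at[OF \<gamma>(5)[OF s]] by simp
  qed
  then have "regular_curve_in L (-e) e \<gamma>"
    using \<gamma> by (auto simp: regular_curve_in_def)
  then show "\<exists>\<gamma> e. 0 < e \<and> regular_curve_in L (- e) e \<gamma> \<and> \<gamma> 0 = p" using \<gamma> by blast
next
  fix a b \<gamma> \<tau> assume reg: "regular_curve_in L a b \<gamma>" and \<tau>: "\<tau> \<in> {a<..<b}"
  obtain U \<phi> w where U: "\<gamma> \<tau> \<in> U" "adapted F t\<^sub>0 U \<phi> w"
    "\<And>X Y. web_connection F t\<^sub>0 X Y (\<gamma> \<tau>) = local_connection U \<phi> w X Y (\<gamma> \<tau>)"
    by (rule web_connection_local[OF web t\<^sub>0, of "\<gamma> \<tau>"]) (rule that)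
  interpret web_coords U \<phi> w by (rule adapted_web_coords[OF U(2)])
  have \<gamma>: "smooth_on {a<..<b} \<gamma>" "\<gamma> ` {a<..<b} \<subseteq> L" "vector_derivative \<gamma> (at \<tau>) \<noteq> 0"
    using reg \<tau> by (auto simp: regular_curve_in_def)
  show "\<exists>c. acceleration (web_connection F t\<^sub>0) \<gamma> \<tau> = c *\<^sub>R vector_derivative \<gamma> (at \<tau>)"
    by (rule geodesic_equation[where \<gamma> = \<gamma> and \<tau> = \<tau> and nab = "web_connection F t\<^sub>0", OF \<gamma>(1) \<tau> U(1,3) t\<^sub>0 \<gamma>(3)])
      (rule tangent_slope[OF web U(2) _ velocity_in_tangent[OF L \<gamma>(1,2)]])
qed

theorem proposition2p2:
  fixes F :: "real \<Rightarrow> real \<Rightarrow> (real^2) set set" and t\<^sub>0 :: real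
  assumes "veronese_web F" and "t\<^sub>0 \<noteq> 0"
  shows "(\<forall>t. \<forall>L\<in>F 1 t. unparametrised_geodesic (web_connection F t\<^sub>0) L) \<and>
    (\<forall>X Y p. smooth_on UNIV X \<and> smooth_on UNIV Y \<longrightarrow> torsion (web_connection F t\<^sub>0) X Y p = 0) \<and>
    (\<forall>Y Z p. smooth_on UNIV Y \<and> smooth_on UNIV Z \<longrightarrow>
       ricci (web_connection F t\<^sub>0) Y Z p = - ricci (web_connection F t\<^sub>0) Z Y p)"
proof (intro conjI allI ballI impI)
  show "unparametrised_geodesic (web_connection F t\<^sub>0) L" if "L \<in> F 1 t" for t L
    by (rule leaf_geodesic[OF assms that])
next
  fix X Y :: vfield and p assume smooth: "smooth_on UNIV X \<and> smooth_on UNIV Y"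
  obtain U \<phi> w where U: "p \<in> U" "adapted F t\<^sub>0 U \<phi> w"
    "\<And>X Y. web_connection F t\<^sub>0 X Y p = local_connection U \<phi> w X Y p"
    by (rule web_connection_local[OF assms, of p]) (rule that)
  interpret web_coords U \<phi> w by (rule adapted_web_coords[OF U(2)])
  show "torsion (web_connection F t\<^sub>0) X Y p = 0"
    using torsion_local_connection[OF U(1), of X Y] smooth
      smooth_on_subset[of UNIV X U] smooth_on_subset[of UNIV Y U] by (simp add: torsion_def U(3))
next
  fix Y Z :: vfield and p assume smooth: "smooth_on UNIV Y \<and> smooth_on UNIV Z"
  obtain U \<phi> w where U: "p \<in> U" "adapted F t\<^sub>0 U \<phi> w"
    "\<And>X Y. web_connection F t\<^sub>0 X Y p = local_connection U \<phi> w X Y p"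
    "\<And>X Y q. q \<in> U \<Longrightarrow> smooth_on UNIV Y \<Longrightarrow> web_connection F t\<^sub>0 X Y q = local_connection U \<phi> w X Y q"
    by (rule web_connection_local[OF assms, of p]) (rule that)
  interpret web_coords U \<phi> w by (rule adapted_web_coords[OF U(2)])
  \<comment> \<open>The same chart serves both orders of the arguments, and the formula is a
    determinant in the components of \<open>Z\<close> and \<open>Y\<close> times a factor
    independent of them.\<close>
  note eq = ricci_eq[OF U(1) _ _ U(4,3)]
  show "ricci (web_connection F t\<^sub>0) Y Z p = - ricci (web_connection F t\<^sub>0) Z Y p"
    using eq[of Y Z] eq[of Z Y] smooth by (simp add: algebra_simps)
qed

end
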